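(* Let $p>1$, $\alpha\ge 0$, $\beta>0$. Let $H$ be a Hilbert space, let $\mathcal A:\mathrm{KRu}(Z)\to H$ be linear and continuous, and let $F:H\to(-\infty,+\infty]$ be proper, convex, coercive and lower semicontinuous. Then the optimization problem $$\inf_{\mu\in\mathrm{KRu}(Z)}F(\mathcal A\mu)+G_{\alpha,\beta}(\mu)$$ admits a minimizer.
   Context: $(Z,d)$ is a complete, separable, locally compact, geodesic metric space with a distinguished base point $e\in Z$. $\mathcal M(Z)$ is the space of bounded (finite signed) Borel measures on $Z$, $|\mu|$ is the total variation measure of $\mu$, and for $p>0$, $\mathcal M_p(Z)=\{\mu\in\mathcal M(Z):\int_Z d(z,e)^p\,\mathrm d|\mu|(z)<\infty\}$. For $f:Z\to\mathbb R$ put $L(f)=\sup_{z\neq z'}|f(z)-f(z')|/d(z,z')$. On $\mathcal M_1(Z)$ define the norm $$\|\mu\|_{\mathrm{KRu}}=|\mu(Z)|+\sup\left\{\int_Z f\,\mathrm d\mu:\ f(e)=0,\ L(f)\le 1\right\},$$ and let $\mathrm{KRu}(Z)$ be the completion of $\mathcal M_1(Z)$ in this norm. The regularizer $G_{\alpha,\beta}:\mathrm{KRu}(Z)\to[0,\infty]$ is $$G_{\alpha,\beta}(\mu)=\alpha\|\mu\|_{\mathrm{KRu}}+\beta\int_Z(1+d(z,e)^p)\,\mathrm d|\mu|(z)\ \text{ if }\mu\in\mathcal M_p(Z),\qquad G_{\alpha,\beta}(\mu)=+\infty\ \text{ otherwise.}$$ Coercive means $F(h)\to+\infty$ as $\|h\|\to\infty$.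 *)

theory Defs
  imports "HOL-Analysis.Analysis"
begin

section \<open>Geodesic spaces and Lipschitz constants\<close>

definition geodesic_space :: "'z::metric_space itself \<Rightarrow> bool" where
  "geodesic_space _ \<longleftrightarrow>
     (\<forall>x y :: 'z. \<exists>\<gamma> :: real \<Rightarrow> 'z. \<gamma> 0 = x \<and> \<gamma> (dist x y) = y \<and>
        (\<forall>s\<in>{0..dist x y}. \<forall>t\<in>{0..dist x y}. dist (\<gamma> s) (\<gamma> t) = \<bar>s - t\<bar>))"

definition lipschitz_constant :: "('z::metric_space \<Rightarrow> real) \<Rightarrow> ennreal" where
  "lipschitz_constant f =
     (SUP (z, z') \<in> {(z, z'). z \<noteq> z'}. ennreal (\<bar>f z - f z'\<bar> / dist z z'))"


section \<open>Finite signed Borel measures\<close>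

text \<open>
  A finite signed Borel measure is a countably additive real-valued set function on the Borel sets.
  It is required to vanish off the Borel sets, so that equality of set functions is equality of
  measures. The vector space operations are pointwise. Countable additivity already forces
  \<open>\<mu> {} = 0\<close>.
\<close>

definition signed_borel_measures :: "('z::topological_space set \<Rightarrow> real) set" where
  "signed_borel_measures =
     {\<mu>. (\<forall>A. A \<notin> sets borel \<longrightarrow> \<mu> A = 0) \<and>
         (\<forall>D :: nat \<Rightarrow> 'z set. range D \<subseteq> sets borel \<longrightarrow> disjoint_family D \<longrightarrow>
            (\<lambda>n. \<mu> (D n)) sums \<mu> (\<Union>n. D n))}"

definition total_variation :: "('z::topological_space set \<Rightarrow> real) \<Rightarrow> 'z measure" where
  "total_variation \<mu> = measure_of UNIV (sets borel)
     (\<lambda>A. SUP D \<in> {D :: nat \<Rightarrow> 'z set. range D \<subseteq> sets borel \<and> disjoint_family D \<and> (\<Union>n. D n) = A}.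
            (\<Sum>n. ennreal \<bar>\<mu> (D n)\<bar>))"

text \<open>The Jordan decomposition \<open>\<mu> = \<mu>\<^sup>+ - \<mu>\<^sup>-\<close> with \<open>\<mu>\<^sup>\<plusminus> = (\<bar>\<mu>\<bar> \<plusminus> \<mu>) / 2\<close>.\<close>

definition positive_variation :: "('z::topological_space set \<Rightarrow> real) \<Rightarrow> 'z measure" where
  "positive_variation \<mu> = measure_of UNIV (sets borel)
     (\<lambda>A. ennreal ((measure (total_variation \<mu>) A + \<mu> A) / 2))"

definition negative_variation :: "('z::topological_space set \<Rightarrow> real) \<Rightarrow> 'z measure" where
  "negative_variation \<mu> = measure_of UNIV (sets borel)
     (\<lambda>A. ennreal ((measure (total_variation \<mu>) A - \<mu> A) / 2))"

definition signed_integral ::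
    "('z::topological_space set \<Rightarrow> real) \<Rightarrow> ('z \<Rightarrow> real) \<Rightarrow> real" where
  "signed_integral \<mu> f =
     integral\<^sup>L (positive_variation \<mu>) f - integral\<^sup>L (negative_variation \<mu>) f"

definition moment_measures :: "'z::metric_space \<Rightarrow> real \<Rightarrow> ('z set \<Rightarrow> real) set" where
  "moment_measures e p =
     {\<mu> \<in> signed_borel_measures.
        (\<integral>\<^sup>+ z. ennreal (dist z e powr p) \<partial>total_variation \<mu>) < \<infinity>}"


section \<open>The Kantorovich--Rubinstein norm and its completion\<close>

text \<open>
  The supremum is a real one. On \<open>moment_measures e 1\<close> the set of integrals contains 0 and is
  bounded above by the first moment of \<open>\<bar>\<mu>\<bar>\<close>.
\<close>

definition KRu_norm :: "'z::metric_space \<Rightarrow> ('z set \<Rightarrow> real) \<Rightarrow> real" where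
  "KRu_norm e \<mu> = \<bar>\<mu> UNIV\<bar> +
     Sup {signed_integral \<mu> f | f. f e = 0 \<and> lipschitz_constant f \<le> 1}"

text \<open>
  The completion depends on the term \<open>e\<close>, so it is not a type constructor applied to the type
  of \<open>Z\<close>. It is given by what defines a completion up to isometric isomorphism: a
  Banach space together with a linear isometry \<open>\<iota>\<close> from the measures with finite first moment onto
  a dense subspace. The values of \<open>\<iota>\<close> outside \<open>moment_measures e 1\<close> are irrelevant.
\<close>

definition KRu_completion ::
    "'z::metric_space \<Rightarrow> (('z set \<Rightarrow> real) \<Rightarrow> 'k::banach) \<Rightarrow> bool" where
  "KRu_completion e \<iota> \<longleftrightarrow>
     (\<forall>\<mu>\<in>moment_measures e 1. \<forall>\<nu>\<in>moment_measures e 1. \<forall>a b :: real.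
        \<iota> (\<lambda>A. a * \<mu> A + b * \<nu> A) = a *\<^sub>R \<iota> \<mu> + b *\<^sub>R \<iota> \<nu>) \<and>
     (\<forall>\<mu>\<in>moment_measures e 1. norm (\<iota> \<mu>) = KRu_norm e \<mu>) \<and>
     closure (\<iota> ` moment_measures e 1) = UNIV"

text \<open>
  For \<open>p \<ge> 1\<close> the measures with finite \<open>p\<close>-th moment lie in \<open>moment_measures e 1\<close>, on which \<open>\<iota>\<close> is
  injective, so \<open>inv_into\<close> returns the unique measure that the element \<open>x\<close> of the completion
  represents.
\<close>

definition regularizer ::
    "'z::metric_space \<Rightarrow> (('z set \<Rightarrow> real) \<Rightarrow> 'k::banach) \<Rightarrow> real \<Rightarrow> real \<Rightarrow> real \<Rightarrow> 'k \<Rightarrow> ennreal"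
  where
  "regularizer e \<iota> p \<alpha> \<beta> x =
     (if x \<in> \<iota> ` moment_measures e p
      then ennreal (\<alpha> * norm x) + ennreal \<beta> *
             (\<integral>\<^sup>+ z. ennreal (1 + dist z e powr p)
                \<partial>total_variation (inv_into (moment_measures e 1) \<iota> x))
      else \<infinity>)"


section \<open>Extended-real-valued functions on a Hilbert space\<close>

text \<open>Values in \<open>(-\<infinity>, +\<infinity>]\<close> and not identically \<open>+\<infinity>\<close>.\<close>

definition proper_fun :: "('h \<Rightarrow> ereal) \<Rightarrow> bool" where
  "proper_fun F \<longleftrightarrow> (\<forall>h. F h \<noteq> -\<infinity>) \<and> (\<exists>h. F h \<noteq> \<infinity>)"

definition convex_fun :: "('h::real_vector \<Rightarrow> ereal) \<Rightarrow> bool" where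
  "convex_fun F \<longleftrightarrow>
     (\<forall>x y. \<forall>t\<in>{0<..<1::real}.
        F ((1 - t) *\<^sub>R x + t *\<^sub>R y) \<le> ereal (1 - t) * F x + ereal t * F y)"

definition lower_semicontinuous :: "('h::topological_space \<Rightarrow> ereal) \<Rightarrow> bool" where
  "lower_semicontinuous F \<longleftrightarrow> (\<forall>h. F h \<le> Liminf (at h) F)"

definition coercive :: "('h::real_normed_vector \<Rightarrow> ereal) \<Rightarrow> bool" where
  "coercive F \<longleftrightarrow> (F \<longlongrightarrow> \<infinity>) at_infinity"

end

theory Submission
  imports Defs "HOL-Complex_Analysis.Great_Picard"
begin

text \<open>
  The proof is the direct method, carried out in the norm topology: a minimizing sequence of
  measures has bounded moments \<open>\<integral> (1 + d(z, e)\<^sup>p) d\<bar>\<mu>\<bar>\<close>, and the measures whose moments stay below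
  a given bound form a compact subset of \<open>KRu(Z)\<close>
  (\<open>KRu_moment_sublevel_compact\<close>). The limit point is again a measure, its moment is at most the
  limit of the moments, and \<open>F \<circ> \<A>\<close> is lower semicontinuous for the norm; hence the limit point is
  a minimizer.

  To bound the moments along the sequence, \<open>F\<close> must be bounded below. This is where convexity and
  coercivity enter (\<open>coercive_convex_lsc_bounded_below\<close>): the sublevel sets of \<open>F\<close> are nested
  closed convex bounded subsets of a Hilbert space, so if none were empty they would have a common
  point, where \<open>F\<close> would be \<open>-\<infinity>\<close>.

  Compactness rests on two facts. First, closed balls of \<open>Z\<close> are compact
  (\<open>Hopf_Rinow_Cohn_Vossen\<close>), and since \<open>p > 1\<close> the first moment outside a large ball is
  uniformly small. For every \<open>\<delta>\<close> there is therefore a Borel map \<open>r\<close> of \<open>Z\<close> onto finitely many points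
  that moves the measures by at most \<open>\<delta>\<close> in transport distance, uniformly along the sequence
  (\<open>exists_quantizer\<close>). Second, a sequence of positive measures with such quantizers at all scales
  has a convergent subsequence (\<open>KR_compact_of_quantizers\<close>). The limit is built by hand, as the
  image of Lebesgue measure on an interval \<open>[0, m)\<close> under a generalized quantile function: the
  quantizers up to level \<open>k\<close> encode each point by an integer, the distribution functions of these
  codes converge along a subsequence, and the inverses of the limit distribution functions, followed
  by decoding, are step functions \<open>[0, m) \<rightarrow> Z\<close> that converge almost everywhere.

  Signed measures are reduced to positive ones through the Jordan decomposition
  (\<open>Jordan_decomposition_variations\<close>); the positive and the negative variations are extracted
  separately, and minimality of the Jordan decomposition gives the moment bound for the difference
  of the two limits. That the regularizer of the limit point is computed from this very difference
  requires distinct measures to have distinct images in the completion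
  (\<open>KRu_completion_inj_on\<close>).
\<close>

section \<open>Closed balls in locally compact geodesic spaces\<close>

lemma geodesic_space_point_between:
  fixes x y :: "'z::metric_space"
  assumes "geodesic_space TYPE('z)" "0 \<le> s" "s \<le> dist x y"
  obtains w where "dist x w = s" "dist w y = dist x y - s"
proof -
  obtain \<gamma> :: "real \<Rightarrow> 'z" where g: "\<gamma> 0 = x" "\<gamma> (dist x y) = y"
      "\<forall>s\<in>{0..dist x y}. \<forall>t\<in>{0..dist x y}. dist (\<gamma> s) (\<gamma> t) = \<bar>s - t\<bar>"
    using assms(1) unfolding geodesic_space_def by metis
  have "dist x (\<gamma> s) = \<bar>0 - s\<bar>"
    using g(3) assms g(1) by (metis atLeastAtMost_iff zero_le_dist order_refl)
  moreover have "dist (\<gamma> s) y = \<bar>s - dist x y\<bar>"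
    using g(3) assms g(2) by (metis atLeastAtMost_iff zero_le_dist order_refl)
  ultimately show thesis using assms by (intro that[of "\<gamma> s"]) auto
qed

text \<open>
  Finitely many compact neighbourhoods cover the ball, hence also an
  \<open>\<epsilon>\<close>-neighbourhood of it. A point at distance at most \<open>r + \<epsilon>/2\<close> from the centre lies in that
  neighbourhood, because the geodesic to it crosses the ball of radius \<open>r\<close> at distance at most
  \<open>\<epsilon>/2\<close>.
\<close>

lemma locally_compact_cball_extend:
  fixes a :: "'z::polish_space"
  assumes lc: "locally_compact_space (euclidean :: 'z topology)"
    and geo: "geodesic_space TYPE('z)"
    and r: "0 \<le> r" and comp: "compact (cball a r)"
  obtains \<delta> where "\<delta> > 0" "compact (cball a (r + \<delta>))"
proof -
  have "\<forall>x::'z. \<exists>U K. open U \<and> compact K \<and> x \<in> U \<and> U \<subseteq> K"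
    using lc unfolding locally_compact_space_def by simp
  then obtain U K where UK: "\<And>x::'z. open (U x) \<and> compact (K x) \<and> x \<in> U x \<and> U x \<subseteq> K x"
    by metis
  obtain I where I: "finite I" "cball a r \<subseteq> (\<Union>x\<in>I. U x)"
    using compactE_image[OF comp, of UNIV U] UK by (metis UNIV_I UN_I subsetI)
  obtain \<epsilon> where \<epsilon>: "\<epsilon> > 0" "(\<Union>x\<in>cball a r. ball x \<epsilon>) \<subseteq> (\<Union>x\<in>I. U x)"
    using compact_subset_open_imp_ball_epsilon_subset[OF comp _ I(2)] UK by blast
  have "cball a (r + \<epsilon>/2) \<subseteq> (\<Union>x\<in>I. K x)"
  proof
    fix y assume y: "y \<in> cball a (r + \<epsilon>/2)"
    have "\<exists>x\<in>cball a r. dist x y < \<epsilon>"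
    proof (cases "dist a y \<le> r")
      case True then show ?thesis using \<epsilon> by (intro bexI[of _ y]) auto
    next
      case False
      then obtain w where "dist a w = r" "dist w y = dist a y - r"
        using geodesic_space_point_between[OF geo r, of a y] by auto
      with y \<epsilon> show ?thesis by (intro bexI[of _ w]) auto
    qed
    then have "y \<in> (\<Union>x\<in>cball a r. ball x \<epsilon>)" by auto
    then have "y \<in> (\<Union>x\<in>I. U x)" using \<epsilon>(2) by blast
    then show "y \<in> (\<Union>x\<in>I. K x)" using UK by blast
  qed
  moreover have "compact (\<Union>x\<in>I. K x)" using I(1) UK by (intro compact_UN) auto
  ultimately have "compact (cball a (r + \<epsilon>/2))"
    by (metis closed_cball compact_Int_closed inf.absorb_iff2)
  with \<epsilon> show thesis by (intro that[of "\<epsilon>/2"]) auto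
qed

text \<open>
  Otherwise the radii of compact balls have a finite supremum \<open>R\<close>. The ball of
  radius \<open>R\<close> is itself compact, being complete and, by following geodesics backwards, within any
  \<open>\<epsilon>\<close> of a smaller compact ball; then local compactness gives a compact ball of larger radius.
\<close>

theorem Hopf_Rinow_Cohn_Vossen:
  fixes a :: "'z::polish_space"
  assumes lc: "locally_compact_space (euclidean :: 'z topology)"
    and geo: "geodesic_space TYPE('z)"
  shows "compact (cball a r)"
proof (rule ccontr)
  assume nc: "\<not> compact (cball a r)"
  define S where "S = {s. 0 \<le> s \<and> compact (cball a s)}"
  have down: "compact (cball a s)" if "compact (cball a t)" "s \<le> t" for s t
    using that by (metis closed_cball compact_Int_closed inf.absorb_iff2 subset_cball)
  have "0 \<in> S" by (simp add: S_def)
  have ub: "s \<le> r" if "s \<in> S" for s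
    using that nc down[of s r] unfolding S_def by force
  then have bdd: "bdd_above S" by (auto simp: bdd_above_def)
  define R where "R = Sup S"
  have "0 \<le> R" unfolding R_def using \<open>0 \<in> S\<close> bdd by (rule cSup_upper)
  have below: "compact (cball a s)" if sR: "s < R" for s
  proof -
    obtain t where "t \<in> S" "s < t" using less_cSupE[of s S] sR \<open>0 \<in> S\<close> unfolding R_def by blast
    then show ?thesis using down[of t s] by (auto simp: S_def)
  qed
  have "compact (cball a R)"
    unfolding compact_eq_totally_bounded
  proof (intro conjI allI impI)
    show "complete (cball a R)" by (simp add: complete_eq_closed)
    fix \<epsilon> :: real assume "\<epsilon> > 0"
    show "\<exists>k. finite k \<and> cball a R \<subseteq> (\<Union>x\<in>k. ball x \<epsilon>)"
    proof (cases "R - \<epsilon>/2 \<ge> 0")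
      case False
      then have "cball a R \<subseteq> ball a \<epsilon>" using \<open>0 < \<epsilon>\<close> by auto
      then show ?thesis by (intro exI[of _ "{a}"]) auto
    next
      case True
      have "compact (cball a (R - \<epsilon>/2))" using \<open>\<epsilon> > 0\<close> by (intro below) auto
      then obtain k where k: "finite k" "cball a (R - \<epsilon>/2) \<subseteq> (\<Union>x\<in>k. ball x (\<epsilon>/2))"
        unfolding compact_eq_totally_bounded using \<open>\<epsilon> > 0\<close> by (metis half_gt_zero)
      have "cball a R \<subseteq> (\<Union>x\<in>k. ball x \<epsilon>)"
      proof
        fix y assume y: "y \<in> cball a R"
        have "\<exists>w\<in>cball a (R - \<epsilon>/2). dist w y \<le> \<epsilon>/2"
        proof (cases "dist a y \<le> R - \<epsilon>/2")
          case True then show ?thesis using \<open>\<epsilon> > 0\<close> by (intro bexI[of _ y]) auto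
        next
          case False
          then obtain w where "dist a w = R - \<epsilon>/2" "dist w y = dist a y - (R - \<epsilon>/2)"
            using geodesic_space_point_between[OF geo \<open>R - \<epsilon>/2 \<ge> 0\<close>, of a y] by auto
          with y show ?thesis by (intro bexI[of _ w]) auto
        qed
        then obtain w where w: "w \<in> cball a (R - \<epsilon>/2)" "dist w y \<le> \<epsilon>/2" by blast
        then obtain x where "x \<in> k" "dist x w < \<epsilon>/2" using k(2) by auto
        then have "dist x y < \<epsilon>" using w dist_triangle[of x y w] by auto
        then show "y \<in> (\<Union>x\<in>k. ball x \<epsilon>)" using \<open>x \<in> k\<close> by auto
      qed
      with k(1) show ?thesis by blast
    qed
  qed
  then obtain \<delta> where "\<delta> > 0" "compact (cball a (R + \<delta>))"
    using locally_compact_cball_extend[OF lc geo \<open>0 \<le> R\<close>] by blast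
  then have "R + \<delta> \<in> S" using \<open>0 \<le> R\<close> by (auto simp: S_def)
  then have "R + \<delta> \<le> R" unfolding R_def using bdd by (rule cSup_upper)
  then show False using \<open>\<delta> > 0\<close> by simp
qed

section \<open>The Hahn decomposition of a finite signed measure\<close>

lemma signed_borel_measures_sums:
  fixes D :: "nat \<Rightarrow> 'z::topological_space set"
  assumes "\<mu> \<in> signed_borel_measures" "range D \<subseteq> sets borel" "disjoint_family D"
  shows "(\<lambda>n. \<mu> (D n)) sums \<mu> (\<Union>n. D n)"
  using assms unfolding signed_borel_measures_def by blast

lemma signed_borel_measures_empty:
  assumes "\<mu> \<in> signed_borel_measures"
  shows "\<mu> {} = 0"
proof -
  have "(\<lambda>n::nat. \<mu> {}) sums \<mu> (\<Union>n::nat. {})"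
    using signed_borel_measures_sums[OF assms, of "\<lambda>_. {}"] by (auto simp: disjoint_family_on_def)
  then have "summable (\<lambda>n::nat. \<mu> {})" by (simp add: sums_iff)
  then show ?thesis using summable_LIMSEQ_zero LIMSEQ_const_iff by blast
qed

lemma signed_borel_measures_Un:
  fixes A B :: "'z::topological_space set"
  assumes "\<mu> \<in> signed_borel_measures" "A \<in> sets borel" "B \<in> sets borel" "A \<inter> B = {}"
  shows "\<mu> (A \<union> B) = \<mu> A + \<mu> B"
proof -
  have "(\<lambda>n. \<mu> (binaryset A B n)) sums \<mu> (\<Union>n. binaryset A B n)"
    using assms by (intro signed_borel_measures_sums)
      (auto simp: binaryset_def disjoint_family_on_def)
  moreover have "(\<lambda>n. \<mu> (binaryset A B n)) sums (\<mu> A + \<mu> B)"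
    by (rule binaryset_sums) (rule signed_borel_measures_empty[OF assms(1)])
  ultimately show ?thesis using sums_unique2 UN_binaryset_eq by metis
qed

lemma signed_borel_measures_split:
  fixes A B :: "'z::topological_space set"
  assumes "\<mu> \<in> signed_borel_measures" "A \<in> sets borel" "B \<in> sets borel"
  shows "\<mu> A = \<mu> (A \<inter> B) + \<mu> (A - B)"
  using signed_borel_measures_Un[OF assms(1), of "A \<inter> B" "A - B"] assms
  by (metis Diff_disjoint Int_Diff_disjoint Int_Diff_Un sets.Diff sets.Int)

text \<open>
  Call a set bad if \<open>\<mu>\<close> is unbounded on its measurable subsets. A bad set \<open>E\<close> contains a set
  \<open>A\<close> with \<open>\<bar>\<mu> A\<bar> > 1 + \<bar>\<mu> E\<bar>\<close>, so both \<open>A\<close> and \<open>E - A\<close> have measure at least 1 in modulus, and one of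
  them is bad. Keeping the bad part and discarding the other one repeatedly produces infinitely many
  disjoint sets on which \<open>\<bar>\<mu>\<bar> \<ge> 1\<close>, against countable additivity.
\<close>

lemma signed_borel_measures_bounded:
  fixes \<mu> :: "'z::topological_space set \<Rightarrow> real"
  assumes \<mu>: "\<mu> \<in> signed_borel_measures"
  obtains K where "\<And>A. \<bar>\<mu> A\<bar> \<le> K"
proof (rule ccontr)
  assume nt: "\<not> thesis"
  define U where "U E \<longleftrightarrow> E \<in> sets borel \<and> (\<forall>K. \<exists>A\<in>sets borel. A \<subseteq> E \<and> \<bar>\<mu> A\<bar> > K)" for E
  have "U UNIV"
  proof (unfold U_def, intro conjI allI)
    fix K
    have "\<exists>A. \<bar>\<mu> A\<bar> > max K 0" using nt that by (meson not_le)
    then obtain A where A: "\<bar>\<mu> A\<bar> > max K 0" by blast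
    then have "A \<in> sets borel" using \<mu> unfolding signed_borel_measures_def by fastforce
    with A show "\<exists>A\<in>sets borel. A \<subseteq> UNIV \<and> \<bar>\<mu> A\<bar> > K" by auto
  qed auto
  have step: "\<exists>B. U B \<and> B \<subseteq> E \<and> \<bar>\<mu> (E - B)\<bar> \<ge> 1" if E: "U E" for E
  proof -
    obtain A where A: "A \<in> sets borel" "A \<subseteq> E" "\<bar>\<mu> A\<bar> > 1 + \<bar>\<mu> E\<bar>"
      using E unfolding U_def by blast
    have Eb: "E \<in> sets borel" using E by (simp add: U_def)
    have "\<mu> E = \<mu> A + \<mu> (E - A)"
      using signed_borel_measures_split[OF \<mu> Eb A(1)] A(2) by (simp add: Int_absorb1)
    then have 1: "\<bar>\<mu> (E - A)\<bar> \<ge> 1" using A(3) by linarith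
    have "U A \<or> U (E - A)"
    proof (rule ccontr)
      assume "\<not> (U A \<or> U (E - A))"
      then obtain K1 K2 where K: "\<And>C. C \<in> sets borel \<Longrightarrow> C \<subseteq> A \<Longrightarrow> \<bar>\<mu> C\<bar> \<le> K1"
          "\<And>C. C \<in> sets borel \<Longrightarrow> C \<subseteq> E - A \<Longrightarrow> \<bar>\<mu> C\<bar> \<le> K2"
        using A(1) Eb unfolding U_def by (metis not_less sets.Diff)
      obtain C where C: "C \<in> sets borel" "C \<subseteq> E" "\<bar>\<mu> C\<bar> > K1 + K2"
        using E unfolding U_def by blast
      have "\<mu> C = \<mu> (C \<inter> A) + \<mu> (C - A)" by (rule signed_borel_measures_split[OF \<mu> C(1) A(1)])
      moreover have "\<bar>\<mu> (C \<inter> A)\<bar> \<le> K1" "\<bar>\<mu> (C - A)\<bar> \<le> K2" using C A by (auto intro!: K)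
      ultimately show False using C(3) by linarith
    qed
    then show ?thesis
    proof
      assume "U A" then show ?thesis using A(2) 1 by blast
    next
      assume "U (E - A)"
      moreover have "E - (E - A) = A" using A(2) by blast
      ultimately show ?thesis using A(3) by (intro exI[of _ "E - A"]) auto
    qed
  qed
  have "\<exists>E. \<forall>n::nat. U (E n) \<and> E (Suc n) \<subseteq> E n \<and> \<bar>\<mu> (E n - E (Suc n))\<bar> \<ge> 1"
    by (rule dependent_nat_choice[where P="\<lambda>_. U" and Q="\<lambda>_ E B. B \<subseteq> E \<and> \<bar>\<mu> (E - B)\<bar> \<ge> 1"])
      (use \<open>U UNIV\<close> step in blast)+
  then obtain E where E: "\<And>n::nat. U (E n)" "\<And>n. E (Suc n) \<subseteq> E n"
      "\<And>n. \<bar>\<mu> (E n - E (Suc n))\<bar> \<ge> 1" by blast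
  have dec: "E n \<subseteq> E m" if "m \<le> n" for m n using lift_Suc_antimono_le[of E, OF E(2) that] .
  have "disjoint_family (\<lambda>n. E n - E (Suc n))"
    unfolding disjoint_family_on_def
  proof (intro ballI impI)
    fix m n :: nat assume "m \<noteq> n"
    then consider "Suc m \<le> n" | "Suc n \<le> m" by linarith
    then show "(E m - E (Suc m)) \<inter> (E n - E (Suc n)) = {}"
      by cases (use dec in blast)+
  qed
  then have "(\<lambda>n. \<mu> (E n - E (Suc n))) sums \<mu> (\<Union>n. E n - E (Suc n))"
    using E(1) by (intro signed_borel_measures_sums[OF \<mu>]) (auto simp: U_def)
  then have "(\<lambda>n. \<mu> (E n - E (Suc n))) \<longlonglongrightarrow> 0"
    by (intro summable_LIMSEQ_zero) (simp add: sums_iff)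
  then have "(\<lambda>n. \<bar>\<mu> (E n - E (Suc n))\<bar>) \<longlonglongrightarrow> 0" by (rule tendsto_rabs_zero)
  then have "1 \<le> (0::real)" by (rule LIMSEQ_le_const) (use E(3) in blast)
  then show False by simp
qed

lemma signed_borel_measures_incseq:
  fixes A :: "nat \<Rightarrow> 'z::topological_space set"
  assumes \<mu>: "\<mu> \<in> signed_borel_measures" and A: "range A \<subseteq> sets borel" "incseq A"
  shows "(\<lambda>n. \<mu> (A n)) \<longlonglongrightarrow> \<mu> (\<Union>n. A n)"
proof -
  have "(\<lambda>n. \<mu> (disjointed A n)) sums \<mu> (\<Union>n. disjointed A n)"
    using A by (intro signed_borel_measures_sums[OF \<mu>] disjoint_family_disjointed)
      (use sets.range_disjointed_sets in blast)
  then have "(\<lambda>n. \<Sum>i<n. \<mu> (disjointed A i)) \<longlonglongrightarrow> \<mu> (\<Union>n. A n)"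
    by (simp add: sums_def UN_disjointed_eq)
  then have lim: "(\<lambda>n. \<Sum>i<Suc n. \<mu> (disjointed A i)) \<longlonglongrightarrow> \<mu> (\<Union>n. A n)"
    by (rule LIMSEQ_Suc)
  have "(\<Sum>i<Suc n. \<mu> (disjointed A i)) = \<mu> (A n)" for n
  proof (induction n)
    case 0 then show ?case by (simp add: disjointed_def)
  next
    case (Suc n)
    have "disjointed A (Suc n) = A (Suc n) - A n"
      using A(2) by (simp add: disjointed_mono mono_def incseq_def)
    moreover have "\<mu> (A (Suc n)) = \<mu> (A n) + \<mu> (A (Suc n) - A n)"
      using signed_borel_measures_split[OF \<mu>, of "A (Suc n)" "A n"] A
      by (metis Int_absorb1 incseq_SucD range_subsetD)
    ultimately show ?case using Suc by simp
  qed
  then show ?thesis using lim by simp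
qed

lemma signed_borel_measures_decseq:
  fixes A :: "nat \<Rightarrow> 'z::topological_space set"
  assumes \<mu>: "\<mu> \<in> signed_borel_measures" and A: "range A \<subseteq> sets borel" "decseq A"
  shows "(\<lambda>n. \<mu> (A n)) \<longlonglongrightarrow> \<mu> (\<Inter>n. A n)"
proof -
  have compl: "\<mu> B = \<mu> UNIV - \<mu> (- B)" if "B \<in> sets borel" for B
    using signed_borel_measures_split[OF \<mu>, of UNIV B] that by (simp add: Compl_eq_Diff_UNIV)
  have "(\<lambda>n. \<mu> (- A n)) \<longlonglongrightarrow> \<mu> (\<Union>n. - A n)"
    using A by (intro signed_borel_measures_incseq[OF \<mu>]) (auto simp: decseq_def incseq_def)
  then have "(\<lambda>n. \<mu> UNIV - \<mu> (- A n)) \<longlonglongrightarrow> \<mu> UNIV - \<mu> (\<Union>n. - A n)"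
    by (intro tendsto_intros)
  moreover have "(\<Inter>n. A n) \<in> sets borel" using A(1) by (intro sets.countable_INT) auto
  ultimately show ?thesis using compl[of "A _"] compl[of "\<Inter>n. A n"] A(1)
    by (simp add: range_subsetD)
qed

text \<open>
  A set \<open>H\<close> on which \<open>\<mu>\<close> attains its supremum \<open>s\<close> is a Hahn set, since removing a subset or
  adding a disjoint set cannot increase \<open>\<mu>\<close>. Such a set is the limes inferior of sets \<open>A n\<close> with
  \<open>\<mu> (A n) > s - 2\<^sup>-\<^sup>n\<close>: because \<open>\<mu>\<close> of a union is at most \<open>s\<close>, intersecting with one more \<open>A n\<close> costs
  at most \<open>2\<^sup>-\<^sup>n\<close>, and these losses are summable.
\<close>

theorem Hahn_decomposition_signed_borel:
  fixes \<mu> :: "'z::topological_space set \<Rightarrow> real"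
  assumes \<mu>: "\<mu> \<in> signed_borel_measures"
  obtains H where "H \<in> sets borel"
    "\<And>A. A \<in> sets borel \<Longrightarrow> A \<subseteq> H \<Longrightarrow> 0 \<le> \<mu> A"
    "\<And>A. A \<in> sets borel \<Longrightarrow> A \<inter> H = {} \<Longrightarrow> \<mu> A \<le> 0"
proof -
  obtain K where K: "\<And>A. \<bar>\<mu> A\<bar> \<le> K" using signed_borel_measures_bounded[OF \<mu>] by blast
  define s where "s = Sup (\<mu> ` sets borel)"
  have bdd: "bdd_above (\<mu> ` sets borel)" using K by (intro bdd_aboveI[of _ K]) (auto simp: abs_le_iff)
  have le_s: "\<mu> A \<le> s" if "A \<in> sets borel" for A
    unfolding s_def using that bdd by (auto intro: cSup_upper)
  have "\<exists>A\<in>sets borel. s - (1/2)^n < \<mu> A" for n :: nat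
  proof -
    have "s - (1/2)^n < Sup (\<mu> ` sets borel)" by (simp add: s_def)
    then show ?thesis using less_cSupE[of _ "\<mu> ` sets borel"] by blast
  qed
  then obtain A where A: "\<And>n::nat. A n \<in> sets borel" "\<And>n. s - (1/2)^n < \<mu> (A n)" by metis
  define G where "G m n = (\<Inter>i\<in>{m..m+n}. A i)" for m n
  have G_borel: "G m n \<in> sets borel" for m n unfolding G_def using A(1) by auto
  have G: "\<mu> (G m n) \<ge> s - 2 * (1/2)^m + (1/2)^(m+n)" for m n
  proof (induction n)
    case 0 then show ?case using A(2)[of m] by (simp add: G_def)
  next
    case (Suc n)
    have eq: "G m (Suc n) = G m n \<inter> A (m + Suc n)"
      unfolding G_def by (auto simp: le_Suc_eq)
    have "\<mu> (G m n \<union> A (m + Suc n)) = \<mu> (A (m + Suc n)) + \<mu> (G m n - A (m + Suc n))"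
      using signed_borel_measures_Un[OF \<mu> A(1)[of "m + Suc n"], of "G m n - A (m + Suc n)"] A(1) G_borel
      by (metis Diff_disjoint Un_Diff_cancel Un_commute sets.Diff)
    moreover have "\<mu> (G m n) = \<mu> (G m (Suc n)) + \<mu> (G m n - A (m + Suc n))"
      unfolding eq by (rule signed_borel_measures_split[OF \<mu> G_borel A(1)])
    moreover have "\<mu> (G m n \<union> A (m + Suc n)) \<le> s" using G_borel A(1) by (intro le_s) auto
    ultimately have "\<mu> (G m (Suc n)) \<ge> \<mu> (G m n) + \<mu> (A (m + Suc n)) - s" by linarith
    then show ?case using Suc A(2)[of "m + Suc n"] by simp
  qed
  define I where "I m = (\<Inter>n. G m n)" for m
  have I_borel: "I m \<in> sets borel" for m unfolding I_def using G_borel by auto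
  have I: "\<mu> (I m) \<ge> s - 2 * (1/2)^m" for m
  proof -
    have "(\<lambda>n. \<mu> (G m n)) \<longlonglongrightarrow> \<mu> (I m)" unfolding I_def
      using G_borel by (intro signed_borel_measures_decseq[OF \<mu>]) (auto simp: decseq_def G_def)
    moreover have "s - 2 * (1/2)^m \<le> \<mu> (G m n)" for n
      using G[of m n] by (rule order_trans[rotated]) simp
    ultimately show ?thesis by (intro LIMSEQ_le_const) auto
  qed
  define H where "H = (\<Union>m. I m)"
  have H_borel: "H \<in> sets borel" unfolding H_def using I_borel by auto
  have "I m \<subseteq> I n" if "m \<le> n" for m n
  proof
    fix x assume x: "x \<in> I m"
    have "x \<in> A i" if "i \<ge> m" for i
      using x that unfolding I_def G_def by (auto dest!: spec[of _ "i - m"])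
    then show "x \<in> I n" using \<open>m \<le> n\<close> unfolding I_def G_def by auto
  qed
  then have "(\<lambda>m. \<mu> (I m)) \<longlonglongrightarrow> \<mu> H" unfolding H_def
    using I_borel by (intro signed_borel_measures_incseq[OF \<mu>]) (auto simp: incseq_def)
  moreover have "(\<lambda>m. s - 2 * (1/2)^m) \<longlonglongrightarrow> s - 2 * 0" by (intro tendsto_intros LIMSEQ_power_zero) auto
  ultimately have "s \<le> \<mu> H" using I by (intro LIMSEQ_le[of "\<lambda>m. s - 2 * (1/2)^m" s]) auto
  show thesis
  proof (rule that[OF H_borel])
    fix B :: "'z set" assume B: "B \<in> sets borel" "B \<subseteq> H"
    have "\<mu> H = \<mu> B + \<mu> (H - B)"
      using signed_borel_measures_split[OF \<mu> H_borel B(1)] B(2) by (simp add: Int_absorb1)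
    then show "0 \<le> \<mu> B" using le_s[of "H - B"] \<open>s \<le> \<mu> H\<close> H_borel B by force
  next
    fix B :: "'z set" assume B: "B \<in> sets borel" "B \<inter> H = {}"
    have "\<mu> (H \<union> B) = \<mu> H + \<mu> B" using H_borel B by (intro signed_borel_measures_Un[OF \<mu>]) auto
    then show "\<mu> B \<le> 0" using le_s[of "H \<union> B"] \<open>s \<le> \<mu> H\<close> H_borel B by force
  qed
qed

section \<open>The Jordan decomposition\<close>

lemma emeasure_measure_of_borel_real:
  fixes g :: "'z::topological_space set \<Rightarrow> real"
  assumes nn: "\<And>A. A \<in> sets borel \<Longrightarrow> 0 \<le> g A"
    and sums: "\<And>D :: nat \<Rightarrow> 'z set. range D \<subseteq> sets borel \<Longrightarrow> disjoint_family D
      \<Longrightarrow> (\<lambda>n. g (D n)) sums g (\<Union>n. D n)"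
    and B: "B \<in> sets borel"
  shows "emeasure (measure_of UNIV (sets borel) (\<lambda>A. ennreal (g A))) B = ennreal (g B)"
proof (rule emeasure_measure_of_sigma[OF _ _ _ B])
  show "sigma_algebra UNIV (sets (borel :: 'z measure))"
    by (metis sets.sigma_algebra_axioms space_borel)
  have "(\<lambda>n::nat. g {}) sums g (\<Union>n::nat. {})"
    using sums[of "\<lambda>_. {}"] by (auto simp: disjoint_family_on_def)
  then have "(\<lambda>n::nat. g {}) \<longlonglongrightarrow> 0" by (intro summable_LIMSEQ_zero) (simp add: sums_iff)
  then have "g {} = 0" using LIMSEQ_const_iff by blast
  then show "positive (sets borel) (\<lambda>A. ennreal (g A))" by (simp add: positive_def)
  show "countably_additive (sets borel) (\<lambda>A. ennreal (g A))"
  proof (rule countably_additiveI)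
    fix D :: "nat \<Rightarrow> 'z set"
    assume D: "range D \<subseteq> sets borel" "disjoint_family D"
    show "(\<Sum>n. ennreal (g (D n))) = ennreal (g (\<Union>n. D n))"
      using sums[OF D] nn D(1) by (intro suminf_ennreal_eq) auto
  qed
qed

lemma signed_borel_measures_restrict_sums:
  fixes D :: "nat \<Rightarrow> 'z::topological_space set"
  assumes "\<mu> \<in> signed_borel_measures" "range D \<subseteq> sets borel" "disjoint_family D" "H \<in> sets borel"
  shows "(\<lambda>n. \<mu> (D n \<inter> H)) sums \<mu> ((\<Union>n. D n) \<inter> H)"
proof -
  have "(\<lambda>n. \<mu> (D n \<inter> H)) sums \<mu> (\<Union>n. D n \<inter> H)"
    using assms by (intro signed_borel_measures_sums) (auto simp: disjoint_family_on_def)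
  then show ?thesis by simp
qed

text \<open>
  With a Hahn set \<open>H\<close>, the partition of \<open>A\<close> into \<open>A \<inter> H\<close> and \<open>A - H\<close> attains the
  supremum that defines the total variation, so all three variation measures have explicit
  values, which are in particular finite.
\<close>

theorem Jordan_decomposition_variations:
  fixes \<mu> :: "'z::topological_space set \<Rightarrow> real"
  assumes \<mu>: "\<mu> \<in> signed_borel_measures"
  obtains H where "H \<in> sets borel"
    "\<And>A. A \<in> sets borel \<Longrightarrow> 0 \<le> \<mu> (A \<inter> H)"
    "\<And>A. A \<in> sets borel \<Longrightarrow> \<mu> (A - H) \<le> 0"
    "\<And>A. A \<in> sets borel \<Longrightarrow> emeasure (positive_variation \<mu>) A = ennreal (\<mu> (A \<inter> H))"
    "\<And>A. A \<in> sets borel \<Longrightarrow> emeasure (negative_variation \<mu>) A = ennreal (- \<mu> (A - H))"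
    "\<And>A. A \<in> sets borel \<Longrightarrow> emeasure (total_variation \<mu>) A = ennreal (\<mu> (A \<inter> H) - \<mu> (A - H))"
proof -
  obtain H where H: "H \<in> sets borel"
    "\<And>A. A \<in> sets borel \<Longrightarrow> A \<subseteq> H \<Longrightarrow> 0 \<le> \<mu> A"
    "\<And>A. A \<in> sets borel \<Longrightarrow> A \<inter> H = {} \<Longrightarrow> \<mu> A \<le> 0"
    using Hahn_decomposition_signed_borel[OF \<mu>] by blast
  define p where "p A = \<mu> (A \<inter> H)" for A
  define n where "n A = - \<mu> (A - H)" for A
  have p: "0 \<le> p A" and n: "0 \<le> n A" and pn: "\<mu> A = p A - n A" if "A \<in> sets borel" for A
    using that H signed_borel_measures_split[OF \<mu> that H(1)]
    by (auto simp: p_def n_def Diff_Int_distrib2)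
  have p_sums: "(\<lambda>i. p (D i)) sums p (\<Union>i. D i)" and n_sums: "(\<lambda>i. n (D i)) sums n (\<Union>i. D i)"
    if D: "range D \<subseteq> sets borel" "disjoint_family D" for D :: "nat \<Rightarrow> 'z set"
    unfolding p_def n_def Diff_eq
    using H(1) by (intro sums_minus signed_borel_measures_restrict_sums[OF \<mu> D]; simp)+
  have SUP_eq: "(SUP D \<in> {D :: nat \<Rightarrow> 'z set. range D \<subseteq> sets borel \<and> disjoint_family D \<and> (\<Union>n. D n) = A}.
            (\<Sum>n. ennreal \<bar>\<mu> (D n)\<bar>)) = ennreal (p A + n A)" if A: "A \<in> sets borel" for A
  proof (rule antisym)
    show "(SUP D \<in> {D :: nat \<Rightarrow> 'z set. range D \<subseteq> sets borel \<and> disjoint_family D \<and> (\<Union>n. D n) = A}.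
            (\<Sum>n. ennreal \<bar>\<mu> (D n)\<bar>)) \<le> ennreal (p A + n A)"
    proof (rule SUP_least, clarify)
      fix D :: "nat \<Rightarrow> 'z set" assume D: "range D \<subseteq> sets borel" "disjoint_family D"
      have "(\<Sum>i. ennreal \<bar>\<mu> (D i)\<bar>) \<le> (\<Sum>i. ennreal (p (D i) + n (D i)))"
      proof (intro suminf_le ennreal_leI)
        fix i
        have "D i \<in> sets borel" using D(1) by auto
        then show "\<bar>\<mu> (D i)\<bar> \<le> p (D i) + n (D i)" using p[of "D i"] n[of "D i"] pn[of "D i"] by linarith
      qed auto
      also have "\<dots> = ennreal (p (\<Union>i. D i) + n (\<Union>i. D i))"
        using D p n by (intro suminf_ennreal_eq sums_add p_sums n_sums add_nonneg_nonneg) auto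
      finally show "(\<Sum>i. ennreal \<bar>\<mu> (D i)\<bar>) \<le> ennreal (p (\<Union>i. D i) + n (\<Union>i. D i))" .
    qed
    have "ennreal (p A + n A) = ennreal \<bar>\<mu> (A \<inter> H)\<bar> + ennreal \<bar>\<mu> (A - H)\<bar>"
      using p[OF A] n[OF A] by (subst ennreal_plus[symmetric]) (simp_all add: p_def n_def)
    also have "\<dots> = (\<Sum>i. ennreal \<bar>\<mu> (binaryset (A \<inter> H) (A - H) i)\<bar>)"
      using signed_borel_measures_empty[OF \<mu>]
      by (subst suminf_binaryset_eq[where f="\<lambda>A. ennreal \<bar>\<mu> A\<bar>"]) auto
    also have "\<dots> \<le> (SUP D \<in> {D :: nat \<Rightarrow> 'z set. range D \<subseteq> sets borel \<and> disjoint_family D \<and> (\<Union>n. D n) = A}.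
            (\<Sum>n. ennreal \<bar>\<mu> (D n)\<bar>))"
      using A H(1) by (intro SUP_upper)
        (auto simp: binaryset_def disjoint_family_on_def split: if_splits)
    finally show "ennreal (p A + n A) \<le> \<dots>" .
  qed
  have "total_variation \<mu> = measure_of UNIV (sets borel) (\<lambda>A. ennreal (p A + n A))"
    unfolding total_variation_def
  proof (rule measure_of_eq)
    fix A assume "A \<in> sigma_sets UNIV (sets (borel :: 'z measure))"
    then have "A \<in> sets borel" by (metis sets.sigma_sets_eq space_borel)
    then show "(SUP D \<in> {D :: nat \<Rightarrow> 'z set. range D \<subseteq> sets borel \<and> disjoint_family D \<and> (\<Union>n. D n) = A}.
            (\<Sum>n. ennreal \<bar>\<mu> (D n)\<bar>)) = ennreal (p A + n A)" by (rule SUP_eq)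
  qed simp
  then have tv: "emeasure (total_variation \<mu>) A = ennreal (p A + n A)" if "A \<in> sets borel" for A
    using that p n p_sums n_sums
    by (simp add: emeasure_measure_of_borel_real[where g="\<lambda>A. p A + n A"] sums_add)
  have tv': "measure (total_variation \<mu>) A = p A + n A" if "A \<in> sets borel" for A
    using tv[OF that] p[OF that] n[OF that] by (simp add: measure_def del: ennreal_plus)
  have "positive_variation \<mu> = measure_of UNIV (sets borel) (\<lambda>A. ennreal (p A))"
    unfolding positive_variation_def
  proof (rule measure_of_eq)
    fix A assume "A \<in> sigma_sets UNIV (sets (borel :: 'z measure))"
    then have "A \<in> sets borel" by (metis sets.sigma_sets_eq space_borel)
    then show "ennreal ((measure (total_variation \<mu>) A + \<mu> A) / 2) = ennreal (p A)"
      using tv'[of A] pn[of A] by simp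
  qed simp
  then have pv: "emeasure (positive_variation \<mu>) A = ennreal (p A)" if "A \<in> sets borel" for A
    using that p p_sums by (simp add: emeasure_measure_of_borel_real[where g=p])
  have "negative_variation \<mu> = measure_of UNIV (sets borel) (\<lambda>A. ennreal (n A))"
    unfolding negative_variation_def
  proof (rule measure_of_eq)
    fix A assume "A \<in> sigma_sets UNIV (sets (borel :: 'z measure))"
    then have "A \<in> sets borel" by (metis sets.sigma_sets_eq space_borel)
    then show "ennreal ((measure (total_variation \<mu>) A - \<mu> A) / 2) = ennreal (n A)"
      using tv'[of A] pn[of A] by simp
  qed simp
  then have nv: "emeasure (negative_variation \<mu>) A = ennreal (n A)" if "A \<in> sets borel" for A
    using that n n_sums by (simp add: emeasure_measure_of_borel_real[where g=n])
  show thesis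
    by (rule that[OF H(1)]) (use p n tv pv nv in \<open>auto simp: p_def n_def\<close>)
qed

lemma sets_variations [simp, measurable_cong]:
  fixes \<mu> :: "'z::topological_space set \<Rightarrow> real"
  shows "sets (total_variation \<mu>) = sets borel" "sets (positive_variation \<mu>) = sets borel"
    "sets (negative_variation \<mu>) = sets borel"
  by (simp_all add: total_variation_def positive_variation_def negative_variation_def
      sets.sigma_sets_eq[of "borel :: 'z measure", simplified])

lemma finite_borel_measureI:
  assumes "sets M = sets borel" "emeasure M UNIV < \<infinity>"
  shows "finite_measure M"
  using assms sets_eq_imp_space_eq[OF assms(1)] by (intro finite_measureI) auto

lemma
  fixes \<mu> :: "'z::topological_space set \<Rightarrow> real"
  assumes \<mu>: "\<mu> \<in> signed_borel_measures"
  shows finite_measure_positive_variation: "finite_measure (positive_variation \<mu>)"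
    and finite_measure_negative_variation: "finite_measure (negative_variation \<mu>)"
    and signed_borel_eq_variation_diff:
      "\<mu> A = measure (positive_variation \<mu>) A - measure (negative_variation \<mu>) A"
    and emeasure_total_variation:
      "emeasure (total_variation \<mu>) A = emeasure (positive_variation \<mu>) A + emeasure (negative_variation \<mu>) A"
proof -
  obtain H where H: "H \<in> sets borel"
    "\<And>A. A \<in> sets borel \<Longrightarrow> 0 \<le> \<mu> (A \<inter> H)"
    "\<And>A. A \<in> sets borel \<Longrightarrow> \<mu> (A - H) \<le> 0"
    "\<And>A. A \<in> sets borel \<Longrightarrow> emeasure (positive_variation \<mu>) A = ennreal (\<mu> (A \<inter> H))"
    "\<And>A. A \<in> sets borel \<Longrightarrow> emeasure (negative_variation \<mu>) A = ennreal (- \<mu> (A - H))"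
    "\<And>A. A \<in> sets borel \<Longrightarrow> emeasure (total_variation \<mu>) A = ennreal (\<mu> (A \<inter> H) - \<mu> (A - H))"
    using Jordan_decomposition_variations[OF \<mu>] by blast
  show "finite_measure (positive_variation \<mu>)" "finite_measure (negative_variation \<mu>)"
    by (rule finite_borel_measureI; simp add: H)+
  show "\<mu> A = measure (positive_variation \<mu>) A - measure (negative_variation \<mu>) A"
  proof (cases "A \<in> sets borel")
    case True
    then show ?thesis using H signed_borel_measures_split[OF \<mu> True H(1)] by (simp add: measure_def)
  next
    case False
    then show ?thesis using \<mu> by (simp add: measure_notin_sets signed_borel_measures_def)
  qed
  show "emeasure (total_variation \<mu>) A = emeasure (positive_variation \<mu>) A + emeasure (negative_variation \<mu>) A"
  proof (cases "A \<in> sets borel")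
    case True
    then have "0 \<le> \<mu> (A \<inter> H)" "0 \<le> - \<mu> (A - H)" using H(2,3)[of A] by simp_all
    then show ?thesis using ennreal_plus[of "\<mu> (A \<inter> H)" "- \<mu> (A - H)"] H(4-6)[OF True] by simp
  qed (simp add: emeasure_notin_sets)
qed

text \<open>
  The reason is \<open>\<mu>\<^sup>+ A = \<mu> (A \<inter> H) \<le> M (A \<inter> H) \<le> M A\<close> for a Hahn set \<open>H\<close>.
\<close>

lemma variations_minimal:
  fixes \<mu> :: "'z::topological_space set \<Rightarrow> real"
  assumes \<mu>: "\<mu> \<in> signed_borel_measures"
    and M: "sets M = sets borel" "finite_measure M" and N: "sets N = sets borel" "finite_measure N"
    and eq: "\<And>A. A \<in> sets borel \<Longrightarrow> \<mu> A = measure M A - measure N A"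
  shows "positive_variation \<mu> \<le> M" "negative_variation \<mu> \<le> N"
proof -
  interpret M: finite_measure M by fact
  interpret N: finite_measure N by fact
  obtain H where H: "H \<in> sets borel"
    "\<And>A. A \<in> sets borel \<Longrightarrow> emeasure (positive_variation \<mu>) A = ennreal (\<mu> (A \<inter> H))"
    "\<And>A. A \<in> sets borel \<Longrightarrow> emeasure (negative_variation \<mu>) A = ennreal (- \<mu> (A - H))"
    using Jordan_decomposition_variations[OF \<mu>] by metis
  have "emeasure (positive_variation \<mu>) A \<le> emeasure M A" if A: "A \<in> sets borel" for A
  proof -
    have "\<mu> (A \<inter> H) \<le> measure M (A \<inter> H)" using eq[of "A \<inter> H"] A H(1) by simp
    also have "\<dots> \<le> measure M A" using A M by (intro M.finite_measure_mono) auto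
    finally show ?thesis using H(2)[OF A] by (simp add: M.emeasure_eq_measure)
  qed
  then show "positive_variation \<mu> \<le> M"
    by (metis M(1) emeasure_notin_sets le_funI le_measure_iff order_refl sets_eq_imp_space_eq sets_variations(2))
  have "emeasure (negative_variation \<mu>) A \<le> emeasure N A" if A: "A \<in> sets borel" for A
  proof -
    have "- \<mu> (A - H) \<le> measure N (A - H)" using eq[of "A - H"] A H(1) by simp
    also have "\<dots> \<le> measure N A" using A N by (intro N.finite_measure_mono) auto
    finally show ?thesis using H(3)[OF A] by (simp add: N.emeasure_eq_measure)
  qed
  then show "negative_variation \<mu> \<le> N"
    by (metis N(1) emeasure_notin_sets le_funI le_measure_iff order_refl sets_eq_imp_space_eq sets_variations(3))
qed

lemma measure_diff_in_signed_borel_measures: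
  fixes M N :: "'z::topological_space measure"
  assumes M: "sets M = sets borel" "finite_measure M" and N: "sets N = sets borel" "finite_measure N"
  shows "(\<lambda>A. measure M A - measure N A) \<in> signed_borel_measures"
proof -
  interpret M: finite_measure M by fact
  interpret N: finite_measure N by fact
  show ?thesis unfolding signed_borel_measures_def
    using M(1) N(1)
    by (auto simp: measure_notin_sets intro!: sums_diff M.finite_measure_UNION N.finite_measure_UNION)
qed

section \<open>Sums of measures and integrals against a difference of measures\<close>

text \<open>
  Sums turn identities between signed measures into identities between measures:
  \<open>M - N = M' - N'\<close> becomes \<open>M + N' = M' + N\<close>.
\<close>

definition add_measure :: "'a::topological_space measure \<Rightarrow> 'a measure \<Rightarrow> 'a measure" where
  "add_measure M N = measure_of UNIV (sets borel) (\<lambda>A. emeasure M A + emeasure N A)"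

lemma sets_add_measure [simp, measurable_cong]: "sets (add_measure M N) = sets borel"
  by (simp add: add_measure_def sets.sigma_sets_eq[of "borel", simplified])

lemma emeasure_add_measure:
  assumes "sets M = sets borel" "sets N = sets borel"
  shows "emeasure (add_measure M N) A = emeasure M A + emeasure N A"
proof (cases "A \<in> sets borel")
  case True
  show ?thesis unfolding add_measure_def
  proof (rule emeasure_measure_of_sigma[OF _ _ _ True])
    show "sigma_algebra UNIV (sets (borel :: 'a measure))"
      by (metis sets.sigma_algebra_axioms space_borel)
    show "positive (sets borel) (\<lambda>A. emeasure M A + emeasure N A)" by (simp add: positive_def)
    show "countably_additive (sets borel) (\<lambda>A. emeasure M A + emeasure N A)"
      using assms by (intro countably_additiveI) (simp add: suminf_add[symmetric] suminf_emeasure)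
  qed
next
  case False
  then show ?thesis using assms by (simp add: emeasure_notin_sets)
qed

lemma nn_integral_add_measure:
  assumes M: "sets M = sets borel" and N: "sets N = sets borel" and f: "f \<in> borel_measurable borel"
  shows "(\<integral>\<^sup>+x. f x \<partial>add_measure M N) = (\<integral>\<^sup>+x. f x \<partial>M) + (\<integral>\<^sup>+x. f x \<partial>N)"
  using f
proof (induction rule: borel_measurable_induct)
  case (cong f g)
  then show ?case by (simp add: fun_eq_iff)
next
  case (set A)
  then show ?case by (simp add: M N emeasure_add_measure)
next
  case (mult u c)
  note [measurable_cong] = M N
  from mult show ?case by (simp add: nn_integral_cmult distrib_left)
next
  case (add u v)
  note [measurable_cong] = M N
  from add show ?case by (simp add: nn_integral_add ac_simps)
next
  case (seq U)
  note [measurable_cong] = M N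
  have [measurable]: "U i \<in> borel_measurable borel" for i by fact
  have eq: "(\<integral>\<^sup>+x. Sup (range U) x \<partial>K) = (SUP i. \<integral>\<^sup>+x. U i x \<partial>K)" if [measurable_cong]: "sets K = sets borel" for K
    unfolding SUP_apply image_comp comp_def
    by (rule nn_integral_monotone_convergence_SUP[OF seq(3)]) simp
  have mono: "incseq (\<lambda>i. \<integral>\<^sup>+x. U i x \<partial>K)" for K
    using seq(3) by (auto simp: incseq_def le_fun_def intro!: nn_integral_mono)
  show ?case
    unfolding eq[OF M] eq[OF N] eq[OF sets_add_measure] seq.IH ennreal_SUP_add[OF mono mono, symmetric] ..
qed

lemma
  fixes f :: "'a::topological_space \<Rightarrow> real"
  assumes M: "sets M = sets borel" and N: "sets N = sets borel"
    and fM: "integrable M f" and fN: "integrable N f"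
  shows integrable_add_measure: "integrable (add_measure M N) f"
    and integral_add_measure: "integral\<^sup>L (add_measure M N) f = integral\<^sup>L M f + integral\<^sup>L N f"
proof -
  have [measurable]: "f \<in> borel_measurable borel"
    using fM M by (metis borel_measurable_integrable measurable_cong_sets)
  note add = nn_integral_add_measure[OF M N]
  show i: "integrable (add_measure M N) f"
    using fM fN unfolding integrable_iff_bounded by (subst add) auto
  have fin: "(\<integral>\<^sup>+x. ennreal (f x) \<partial>M) < \<infinity>" "(\<integral>\<^sup>+x. ennreal (f x) \<partial>N) < \<infinity>"
    "(\<integral>\<^sup>+x. ennreal (- f x) \<partial>M) < \<infinity>" "(\<integral>\<^sup>+x. ennreal (- f x) \<partial>N) < \<infinity>"
    using fM fN by (auto simp: real_integrable_def less_top)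
  show "integral\<^sup>L (add_measure M N) f = integral\<^sup>L M f + integral\<^sup>L N f"
    using fin by (simp add: real_lebesgue_integral_def i fM fN add enn2real_plus)
qed

lemma finite_measure_add_measure:
  assumes "sets M = sets borel" "finite_measure M" "sets N = sets borel" "finite_measure N"
  shows "finite_measure (add_measure M N)"
  using assms by (intro finite_borel_measureI)
    (auto simp: emeasure_add_measure finite_measure.emeasure_finite less_top[symmetric])

lemma measure_add_measure:
  assumes "sets M = sets borel" "finite_measure M" "sets N = sets borel" "finite_measure N"
  shows "measure (add_measure M N) A = measure M A + measure N A"
  using assms by (simp add: measure_def emeasure_add_measure enn2real_plus less_top[symmetric]
      finite_measure.emeasure_finite)

lemma total_variation_eq_add_measure:
  assumes "\<mu> \<in> signed_borel_measures"
  shows "total_variation \<mu> = add_measure (positive_variation \<mu>) (negative_variation \<mu>)"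
  by (rule measure_eqI) (simp_all add: emeasure_total_variation[OF assms] emeasure_add_measure)

lemma integrable_mono_measure:
  fixes f :: "'a \<Rightarrow> real"
  assumes "M \<le> N" "sets M = sets N" "integrable N f"
  shows "integrable M f"
  using assms nn_integral_mono_measure[of M N "\<lambda>x. ennreal (norm (f x))"]
  unfolding integrable_iff_bounded by (auto simp: measurable_cong_sets[OF assms(2) refl] elim: le_less_trans)

text \<open>
  Cancellation makes the integral independent of the chosen decomposition: \<open>\<mu>\<^sup>+ + N\<close> and
  \<open>\<mu>\<^sup>- + M\<close> are the same measure, and \<open>f\<close> is integrable for all four summands because
  \<open>\<mu>\<^sup>+ \<le> M\<close> and \<open>\<mu>\<^sup>- \<le> N\<close>.
\<close>

lemma signed_integral_measure_diff:
  fixes \<mu> :: "'z::topological_space set \<Rightarrow> real"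
  assumes \<mu>: "\<mu> \<in> signed_borel_measures"
    and M: "sets M = sets borel" "finite_measure M" and N: "sets N = sets borel" "finite_measure N"
    and eq: "\<And>A. A \<in> sets borel \<Longrightarrow> \<mu> A = measure M A - measure N A"
    and fM: "integrable M f" and fN: "integrable N f"
  shows "signed_integral \<mu> f = integral\<^sup>L M f - integral\<^sup>L N f"
proof -
  let ?P = "positive_variation \<mu>" and ?N = "negative_variation \<mu>"
  note PM = variations_minimal[OF \<mu> M N eq]
  note fin = finite_measure_positive_variation[OF \<mu>] finite_measure_negative_variation[OF \<mu>]
  have fP: "integrable ?P f" and fNv: "integrable ?N f"
    using PM fM fN M N by (auto intro: integrable_mono_measure)
  have "add_measure ?P N = add_measure ?N M"
  proof (rule measure_eqI)
    fix A assume "A \<in> sets (add_measure ?P N)"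
    then have A: "A \<in> sets borel" by simp
    have "measure (add_measure ?P N) A = measure (add_measure ?N M) A"
      using eq[OF A] signed_borel_eq_variation_diff[OF \<mu>, of A]
      by (simp add: measure_add_measure M N fin)
    then show "emeasure (add_measure ?P N) A = emeasure (add_measure ?N M) A"
      by (simp add: finite_measure.emeasure_eq_measure finite_measure_add_measure M N fin)
  qed simp
  then have "integral\<^sup>L ?P f + integral\<^sup>L N f = integral\<^sup>L ?N f + integral\<^sup>L M f"
    using M N fM fN fP fNv by (metis integral_add_measure sets_variations(2,3))
  then show ?thesis by (simp add: signed_integral_def)
qed

section \<open>The Kantorovich--Rubinstein norm\<close>

lemma lipschitz_constant_le_1_iff:
  fixes f :: "'z::metric_space \<Rightarrow> real"
  shows "lipschitz_constant f \<le> 1 \<longleftrightarrow> 1-lipschitz_on UNIV f"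
proof -
  have "lipschitz_constant f \<le> 1 \<longleftrightarrow> (\<forall>x y. x \<noteq> y \<longrightarrow> ennreal (\<bar>f x - f y\<bar> / dist x y) \<le> 1)"
    unfolding lipschitz_constant_def by (auto simp: SUP_le_iff)
  also have "\<dots> \<longleftrightarrow> (\<forall>x y. x \<noteq> y \<longrightarrow> \<bar>f x - f y\<bar> \<le> dist x y)"
    by (simp add: ennreal_le_1 divide_le_eq_1)
  also have "\<dots> \<longleftrightarrow> 1-lipschitz_on UNIV f"
    unfolding lipschitz_on_def dist_real_def by (auto, metis abs_zero cancel_comm_monoid_add_class.diff_cancel dist_self order_refl)
  finally show ?thesis .
qed

lemma lipschitz_on_UNIV_borel_measurable:
  fixes f :: "'z::metric_space \<Rightarrow> real"
  assumes "L-lipschitz_on UNIV f"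
  shows "f \<in> borel_measurable borel"
  using lipschitz_on_continuous_on[OF assms] by (rule borel_measurable_continuous_onI)

lemma lipschitz_abs_le_dist:
  fixes f :: "'z::metric_space \<Rightarrow> real"
  assumes "L-lipschitz_on UNIV f" "f e = 0"
  shows "\<bar>f z\<bar> \<le> L * dist z e"
  using lipschitz_onD[OF assms(1), of z e] assms(2) by (simp add: dist_real_def)

definition finite_first_moment :: "'z::metric_space \<Rightarrow> 'z measure \<Rightarrow> bool" where
  "finite_first_moment e M \<longleftrightarrow> sets M = sets borel \<and> finite_measure M \<and> (\<integral>\<^sup>+z. ennreal (dist z e) \<partial>M) < \<infinity>"

lemma finite_first_momentD:
  assumes "finite_first_moment e M"
  shows "sets M = sets borel" "finite_measure M" "integrable M (\<lambda>z. dist z e)"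
proof -
  show s: "sets M = sets borel" and "finite_measure M"
    using assms unfolding finite_first_moment_def by auto
  note [measurable_cong] = s
  show "integrable M (\<lambda>z. dist z e)"
    using assms unfolding finite_first_moment_def integrable_iff_bounded
    by (auto simp: measurable_cong_sets[OF s refl] intro!: borel_measurable_continuous_onI continuous_intros)
qed

lemma finite_first_momentI:
  assumes "sets M = sets borel" "finite_measure M" "integrable M (\<lambda>z. dist z e)"
  shows "finite_first_moment e M"
  using assms unfolding finite_first_moment_def integrable_iff_bounded by simp

lemma finite_first_moment_integrable_lipschitz:
  fixes f :: "'z::metric_space \<Rightarrow> real"
  assumes M: "finite_first_moment e M" and f: "L-lipschitz_on UNIV f"
  shows "integrable M f"
proof -
  note MD = finite_first_momentD[OF M]
  note [measurable_cong] = MD(1)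
  note [measurable] = lipschitz_on_UNIV_borel_measurable[OF f]
  interpret finite_measure M by (rule MD)
  show ?thesis
  proof (rule Bochner_Integration.integrable_bound)
    show "integrable M (\<lambda>z. \<bar>f e\<bar> + L * dist z e)" using MD(3) by auto
    have "\<bar>f z\<bar> \<le> \<bar>f e\<bar> + L * dist z e" for z
      using lipschitz_onD[OF f, of z e] by (simp add: dist_real_def)
    then show "AE z in M. norm (f z) \<le> norm (\<bar>f e\<bar> + L * dist z e)"
      by (intro AE_I2) (smt (verit) real_norm_def)
  qed measurable
qed

text \<open>
  Reduces integrals of arbitrary Lipschitz functions to the total mass and to the functions over
  which the Kantorovich--Rubinstein norm takes its supremum.
\<close>

lemma lipschitz_normalise:
  fixes f :: "'z::metric_space \<Rightarrow> real"
  assumes f: "L-lipschitz_on UNIV f"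
  obtains g K where "g e = 0" "1-lipschitz_on UNIV g"
    "\<forall>M. finite_first_moment e M \<longrightarrow> integral\<^sup>L M f = K * integral\<^sup>L M g + measure M UNIV * f e"
proof -
  define K where "K = L + 1"
  have K: "K > 0" "K-lipschitz_on UNIV f"
    using lipschitz_on_nonneg[OF f] lipschitz_on_le[OF f, of K] by (auto simp: K_def)
  define g where "g z = (f z - f e) / K" for z
  have g: "1-lipschitz_on UNIV g"
  proof (rule lipschitz_onI)
    fix x y
    have "dist (g x) (g y) = dist (f x) (f y) / K"
      using K(1) by (simp add: g_def dist_real_def diff_divide_distrib[symmetric])
    also have "\<dots> \<le> 1 * dist x y" using lipschitz_onD[OF K(2), of x y] K(1) by (simp add: field_simps)
    finally show "dist (g x) (g y) \<le> 1 * dist x y" .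
  qed simp
  have fg: "f = (\<lambda>z. K * g z + f e)" using K(1) by (auto simp: g_def)
  have "integral\<^sup>L M f = K * integral\<^sup>L M g + measure M UNIV * f e"
    if M: "finite_first_moment e M" for M
  proof -
    note DM = finite_first_momentD[OF M]
    interpret finite_measure M by (rule DM)
    have i: "integrable M g" by (rule finite_first_moment_integrable_lipschitz[OF M g])
    show ?thesis by (subst fg) (simp add: i sets_eq_imp_space_eq[OF DM(1)])
  qed
  then show thesis using g by (intro that[of g K]) (auto simp: g_def)
qed

lemma finite_first_moment_add_measure:
  assumes "finite_first_moment e M" "finite_first_moment e N"
  shows "finite_first_moment e (add_measure M N)"
  using finite_first_momentD[OF assms(1)] finite_first_momentD[OF assms(2)]
  by (intro finite_first_momentI finite_measure_add_measure integrable_add_measure) auto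

lemma finite_first_moment_mono_measure:
  assumes "finite_first_moment e N" "M \<le> N" "sets M = sets borel"
  shows "finite_first_moment e M"
proof -
  note D = finite_first_momentD[OF assms(1)]
  interpret N: finite_measure N by (rule D)
  have "emeasure M UNIV \<le> emeasure N UNIV" using assms D(1) by (intro le_measureD3) auto
  then have "finite_measure M" using assms(3)
    by (intro finite_borel_measureI) (auto simp: N.emeasure_eq_measure intro: le_less_trans)
  then show ?thesis using assms D
    by (intro finite_first_momentI) (auto intro: integrable_mono_measure)
qed

lemma moment_measures_1_iff:
  "\<mu> \<in> moment_measures e 1 \<longleftrightarrow> \<mu> \<in> signed_borel_measures \<and> finite_first_moment e (total_variation \<mu>)"
proof -
  have "finite_measure (total_variation \<mu>)" if "\<mu> \<in> signed_borel_measures"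
    using that by (simp add: total_variation_eq_add_measure finite_measure_add_measure
        finite_measure_positive_variation finite_measure_negative_variation)
  then show ?thesis by (auto simp: moment_measures_def finite_first_moment_def)
qed

lemma moment_measures_1D:
  assumes "\<mu> \<in> moment_measures e 1"
  shows "\<mu> \<in> signed_borel_measures" "finite_first_moment e (positive_variation \<mu>)"
    "finite_first_moment e (negative_variation \<mu>)"
proof -
  show \<mu>: "\<mu> \<in> signed_borel_measures" using assms by (simp add: moment_measures_1_iff)
  have tv: "finite_first_moment e (total_variation \<mu>)" using assms by (simp add: moment_measures_1_iff)
  have "positive_variation \<mu> \<le> total_variation \<mu>" "negative_variation \<mu> \<le> total_variation \<mu>"
    by (auto simp: le_measure_iff le_fun_def emeasure_total_variation[OF \<mu>] dest: sets_eq_imp_space_eq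
        intro!: sets_eq_imp_space_eq)
  then show "finite_first_moment e (positive_variation \<mu>)" "finite_first_moment e (negative_variation \<mu>)"
    using tv by (auto intro: finite_first_moment_mono_measure)
qed

lemma total_variation_le_add_measure:
  assumes \<mu>: "\<mu> \<in> signed_borel_measures"
    and M: "sets M = sets borel" "finite_measure M" and N: "sets N = sets borel" "finite_measure N"
    and eq: "\<And>A. A \<in> sets borel \<Longrightarrow> \<mu> A = measure M A - measure N A"
  shows "total_variation \<mu> \<le> add_measure M N"
proof -
  note m = variations_minimal[OF assms]
  have "emeasure (total_variation \<mu>) A \<le> emeasure (add_measure M N) A" for A
    using m M N by (auto simp: emeasure_total_variation[OF \<mu>] emeasure_add_measure intro!: add_mono le_measureD3)
  then show ?thesis by (auto simp: le_measure_iff le_fun_def intro!: sets_eq_imp_space_eq)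
qed

lemma measure_diff_in_moment_measures_1:
  assumes "finite_first_moment e M" "finite_first_moment e N"
  shows "(\<lambda>A. measure M A - measure N A) \<in> moment_measures e 1"
proof -
  note D = finite_first_momentD[OF assms(1)] finite_first_momentD[OF assms(2)]
  have \<mu>: "(\<lambda>A. measure M A - measure N A) \<in> signed_borel_measures"
    using D by (intro measure_diff_in_signed_borel_measures) auto
  show ?thesis unfolding moment_measures_1_iff
    by (intro conjI \<mu> finite_first_moment_mono_measure[OF finite_first_moment_add_measure[OF assms]]
        total_variation_le_add_measure) (use D in auto)
qed

lemma moment_measures_1_diff:
  assumes "\<mu> \<in> moment_measures e 1" "\<nu> \<in> moment_measures e 1"
  shows "(\<lambda>A. \<mu> A - \<nu> A) \<in> moment_measures e 1"
proof -
  note D\<mu> = moment_measures_1D[OF assms(1)] and D\<nu> = moment_measures_1D[OF assms(2)]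
  have "(\<lambda>A. \<mu> A - \<nu> A) = (\<lambda>A. measure (add_measure (positive_variation \<mu>) (negative_variation \<nu>)) A
      - measure (add_measure (negative_variation \<mu>) (positive_variation \<nu>)) A)"
    using D\<mu> D\<nu> by (auto simp: measure_add_measure finite_first_moment_def
        signed_borel_eq_variation_diff[OF D\<mu>(1)] signed_borel_eq_variation_diff[OF D\<nu>(1)])
  then show ?thesis
    using D\<mu> D\<nu> by (auto intro!: measure_diff_in_moment_measures_1 finite_first_moment_add_measure)
qed

lemma KRu_norm_le:
  assumes \<mu>: "\<mu> \<in> signed_borel_measures"
    and M: "finite_first_moment e M" and N: "finite_first_moment e N"
    and eq: "\<And>A. A \<in> sets borel \<Longrightarrow> \<mu> A = measure M A - measure N A"
    and le: "\<And>f. f e = 0 \<Longrightarrow> 1-lipschitz_on UNIV f \<Longrightarrow> integral\<^sup>L M f - integral\<^sup>L N f \<le> c"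
  shows "KRu_norm e \<mu> \<le> \<bar>\<mu> UNIV\<bar> + c"
  unfolding KRu_norm_def
proof (intro add_left_mono cSup_least)
  have "1-lipschitz_on UNIV (\<lambda>_::'a. 0::real)" by (auto simp: lipschitz_on_def)
  then show "{signed_integral \<mu> f |f. f e = 0 \<and> lipschitz_constant f \<le> 1} \<noteq> {}"
    by (auto simp: lipschitz_constant_le_1_iff)
next
  fix s assume "s \<in> {signed_integral \<mu> f |f. f e = 0 \<and> lipschitz_constant f \<le> 1}"
  then obtain f where f: "s = signed_integral \<mu> f" "f e = 0" "1-lipschitz_on UNIV f"
    by (auto simp: lipschitz_constant_le_1_iff)
  have "s = integral\<^sup>L M f - integral\<^sup>L N f" unfolding f(1)
    using finite_first_momentD[OF M] finite_first_momentD[OF N] f(3) M N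
    by (intro signed_integral_measure_diff[OF \<mu> _ _ _ _ eq] finite_first_moment_integrable_lipschitz) auto
  then show "s \<le> c" using le f by simp
qed

text \<open>
  The supremum in the norm is over a set of reals, so it dominates its members only because
  that set is bounded: \<open>\<bar>f\<bar> \<le> d(\<cdot>, e)\<close> for each competitor, and \<open>\<mu>\<close> has a finite first moment.
\<close>

lemma mass_plus_signed_integral_le_KRu_norm:
  assumes \<mu>: "\<mu> \<in> moment_measures e 1" and f: "f e = 0" "1-lipschitz_on UNIV f"
  shows "\<bar>\<mu> UNIV\<bar> + signed_integral \<mu> f \<le> KRu_norm e \<mu>"
proof -
  let ?P = "positive_variation \<mu>" and ?N = "negative_variation \<mu>"
  note D = moment_measures_1D[OF \<mu>]
  note DP = finite_first_momentD[OF D(2)] and DN = finite_first_momentD[OF D(3)]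
  have "signed_integral \<mu> g \<le> (\<integral>z. dist z e \<partial>?P) + (\<integral>z. dist z e \<partial>?N)"
    if "g e = 0" "lipschitz_constant g \<le> 1" for g
  proof -
    have g: "1-lipschitz_on UNIV g" using that by (simp add: lipschitz_constant_le_1_iff)
    have b: "\<bar>g z\<bar> \<le> dist z e" for z using lipschitz_abs_le_dist[OF g that(1)] by simp
    have i: "integrable ?P g" "integrable ?N g"
      using D g by (auto intro: finite_first_moment_integrable_lipschitz)
    have "integral\<^sup>L ?P g \<le> (\<integral>z. dist z e \<partial>?P)"
      using b by (intro integral_mono i DP) (auto simp: abs_le_iff)
    moreover have "(\<integral>z. - g z \<partial>?N) \<le> (\<integral>z. dist z e \<partial>?N)"
      using b by (intro integral_mono Bochner_Integration.integrable_minus i DN) (auto simp: abs_le_iff)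
    ultimately show ?thesis by (simp add: signed_integral_def)
  qed
  then have "bdd_above {signed_integral \<mu> f |f. f e = 0 \<and> lipschitz_constant f \<le> 1}"
    by (intro bdd_aboveI) auto
  then have "signed_integral \<mu> f \<le> Sup {signed_integral \<mu> f |f. f e = 0 \<and> lipschitz_constant f \<le> 1}"
    using f by (intro cSup_upper) (auto simp: lipschitz_constant_le_1_iff)
  then show ?thesis unfolding KRu_norm_def by linarith
qed

text \<open>
  The indicator of a nonempty closed set \<open>C\<close> is the decreasing limit of the Lipschitz
  functions \<open>max 0 (1 - n * d(z, C))\<close>, and the closed sets generate the Borel sets.
\<close>

lemma finite_borel_measure_eqI_lipschitz:
  fixes M N :: "'z::metric_space measure"
  assumes M: "sets M = sets borel" "finite_measure M" and N: "sets N = sets borel" "finite_measure N"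
    and eq: "\<And>(f :: 'z \<Rightarrow> real) L. L-lipschitz_on UNIV f \<Longrightarrow> (\<And>z. \<bar>f z\<bar> \<le> 1) \<Longrightarrow> integral\<^sup>L M f = integral\<^sup>L N f"
  shows "M = N"
proof (rule measure_eqI_generator_eq[where E="Collect closed" and \<Omega>=UNIV and A="\<lambda>_. UNIV"])
  interpret M: finite_measure M by fact
  interpret N: finite_measure N by fact
  have spM: "space M = UNIV" and spN: "space N = UNIV"
    using sets_eq_imp_space_eq[OF M(1)] sets_eq_imp_space_eq[OF N(1)] by auto
  fix C :: "'z set" assume "C \<in> Collect closed"
  then have C: "closed C" by simp
  show "emeasure M C = emeasure N C"
  proof (cases "C = {}")
    case False
    define g :: "nat \<Rightarrow> 'z \<Rightarrow> real" where "g n z = max 0 (1 - real n * infdist z C)" for n z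
    have g_lip: "(real n)-lipschitz_on UNIV (g n)" for n
    proof (rule lipschitz_onI)
      fix x y
      have "\<bar>g n x - g n y\<bar> \<le> \<bar>(1 - real n * infdist x C) - (1 - real n * infdist y C)\<bar>"
        unfolding g_def by linarith
      also have "\<dots> = real n * \<bar>infdist x C - infdist y C\<bar>"
        by (simp add: abs_minus_commute flip: abs_mult_pos' right_diff_distrib)
      also have "\<dots> \<le> real n * dist x y"
        by (intro mult_left_mono infdist_triangle_abs) auto
      finally show "dist (g n x) (g n y) \<le> real n * dist x y" by (simp add: dist_real_def)
    qed auto
    have g_lim: "(\<lambda>n. g n z) \<longlonglongrightarrow> indicator C z" for z
    proof (cases "z \<in> C")
      case True then show ?thesis by (simp add: g_def)
    next
      case out: False
      then have pos: "infdist z C > 0"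
        using in_closed_iff_infdist_zero[OF C False] infdist_nonneg[of z C] by force
      then obtain n0 where n0: "1 < real n0 * infdist z C" using reals_Archimedean3 by blast
      have "g n z = 0" if "n \<ge> n0" for n
      proof -
        have "real n0 * infdist z C \<le> real n * infdist z C" using that pos by (intro mult_right_mono) auto
        then show ?thesis using n0 unfolding g_def by linarith
      qed
      then show ?thesis using out
        by (intro tendsto_eventually) (auto simp: eventually_sequentially)
    qed
    have lim: "(\<lambda>n. integral\<^sup>L K (g n)) \<longlonglongrightarrow> measure K C"
      if K: "sets K = sets borel" "finite_measure K" for K
    proof -
      interpret K: finite_measure K by fact
      note [measurable_cong] = K(1)
      have [measurable]: "g n \<in> borel_measurable borel" for n
        using g_lip by (rule lipschitz_on_UNIV_borel_measurable)
      have [measurable]: "C \<in> sets borel" using C by simp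
      have "(\<lambda>n. integral\<^sup>L K (g n)) \<longlonglongrightarrow> integral\<^sup>L K (indicator C)"
      proof (rule integral_dominated_convergence[where w="\<lambda>_. 1"])
        show "AE x in K. norm (g n x) \<le> 1" for n
          by (intro AE_I2) (simp add: g_def infdist_nonneg)
      qed (use g_lim in auto)
      then show ?thesis using sets_eq_imp_space_eq[OF K(1)] by simp
    qed
    have "integral\<^sup>L M (g n) = integral\<^sup>L N (g n)" for n
      by (rule eq[OF g_lip]) (simp add: g_def infdist_nonneg)
    then have "measure M C = measure N C"
      using lim[OF M] lim[OF N] LIMSEQ_unique by simp
    then show ?thesis by (simp add: M.emeasure_eq_measure N.emeasure_eq_measure)
  qed simp
next
  show "sets M = sigma_sets UNIV (Collect closed)" "sets N = sigma_sets UNIV (Collect closed)"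
    unfolding M(1) N(1) borel_eq_closed by simp_all
next
  fix i :: nat show "emeasure M UNIV \<noteq> \<infinity>" using M(2) by (simp add: finite_measure.emeasure_finite)
qed (auto simp: Int_stable_def closed_Int)

text \<open>
  Applying the norm bound to \<open>g\<close> and to \<open>- g\<close> shows that \<open>\<mu>\<^sup>+\<close> and \<open>\<mu>\<^sup>-\<close> agree on normalised
  Lipschitz functions; they also have equal mass, so they coincide.
\<close>

lemma KRu_norm_zero_imp:
  assumes \<mu>: "\<mu> \<in> moment_measures e 1" and zero: "KRu_norm e \<mu> = 0"
  shows "\<mu> A = 0"
proof -
  let ?P = "positive_variation \<mu>" and ?N = "negative_variation \<mu>"
  note D = moment_measures_1D[OF \<mu>]
  note DP = finite_first_momentD[OF D(2)] and DN = finite_first_momentD[OF D(3)]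
  have "\<bar>\<mu> UNIV\<bar> + signed_integral \<mu> (\<lambda>_. 0) \<le> 0"
    using mass_plus_signed_integral_le_KRu_norm[OF \<mu>, of "\<lambda>_. 0"] zero by (simp add: lipschitz_on_def)
  then have mass: "measure ?P UNIV = measure ?N UNIV"
    using signed_borel_eq_variation_diff[OF D(1), of UNIV] by (simp add: signed_integral_def)
  have sp: "space ?P = UNIV" "space ?N = UNIV"
    using sets_eq_imp_space_eq[OF DP(1)] sets_eq_imp_space_eq[OF DN(1)] by auto
  have le: "integral\<^sup>L ?P g \<le> integral\<^sup>L ?N g" if "g e = 0" "1-lipschitz_on UNIV g" for g :: "_ \<Rightarrow> real"
    using mass_plus_signed_integral_le_KRu_norm[OF \<mu> that] zero unfolding signed_integral_def by linarith
  have eq1: "integral\<^sup>L ?P g = integral\<^sup>L ?N g" if g: "g e = 0" "1-lipschitz_on UNIV g" for g :: "_ \<Rightarrow> real"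
  proof -
    have "1-lipschitz_on UNIV (\<lambda>z. - g z)" using g(2) by (simp add: lipschitz_on_def dist_minus)
    from le[OF _ this] le[OF g] g(1) show ?thesis by simp
  qed
  have "?P = ?N"
  proof (rule finite_borel_measure_eqI_lipschitz[OF DP(1,2) DN(1,2)])
    fix f :: "'a \<Rightarrow> real" and L assume f: "L-lipschitz_on UNIV f"
    obtain g K where g: "g e = 0" "1-lipschitz_on UNIV g"
        "\<forall>M. finite_first_moment e M \<longrightarrow> integral\<^sup>L M f = K * integral\<^sup>L M g + measure M UNIV * f e"
      by (rule lipschitz_normalise[OF f, of e])
    show "integral\<^sup>L ?P f = integral\<^sup>L ?N f"
      unfolding g(3)[rule_format, OF D(2)] g(3)[rule_format, OF D(3)] eq1[OF g(1,2)] mass ..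
  qed
  then show ?thesis by (simp add: signed_borel_eq_variation_diff[OF D(1)])
qed

lemma KRu_completion_diff:
  assumes \<iota>: "KRu_completion e \<iota>" and \<mu>: "\<mu> \<in> moment_measures e 1" and \<nu>: "\<nu> \<in> moment_measures e 1"
  shows "norm (\<iota> \<mu> - \<iota> \<nu>) = KRu_norm e (\<lambda>A. \<mu> A - \<nu> A)"
proof -
  have "\<iota> (\<lambda>A. 1 * \<mu> A + (-1) * \<nu> A) = 1 *\<^sub>R \<iota> \<mu> + (-1) *\<^sub>R \<iota> \<nu>"
    using \<iota> \<mu> \<nu> unfolding KRu_completion_def by blast
  then have "\<iota> (\<lambda>A. \<mu> A - \<nu> A) = \<iota> \<mu> - \<iota> \<nu>" by simp
  then show ?thesis
    using \<iota> moment_measures_1_diff[OF \<mu> \<nu>] unfolding KRu_completion_def by metis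
qed

text \<open>
  Hence the inverse of \<open>\<iota>\<close> in the regularizer recovers the measure that a point of the completion
  represents.
\<close>

lemma KRu_completion_inj_on:
  assumes \<iota>: "KRu_completion e \<iota>"
  shows "inj_on \<iota> (moment_measures e 1)"
proof (rule inj_onI)
  fix \<mu> \<nu> assume m: "\<mu> \<in> moment_measures e 1" "\<nu> \<in> moment_measures e 1" and "\<iota> \<mu> = \<iota> \<nu>"
  then have "KRu_norm e (\<lambda>A. \<mu> A - \<nu> A) = 0" using KRu_completion_diff[OF \<iota> m] by simp
  then have "\<mu> A - \<nu> A = 0" for A using KRu_norm_zero_imp[OF moment_measures_1_diff[OF m]] by blast
  then show "\<mu> = \<nu>" by (intro ext) simp
qed

section \<open>Compactness of positive measures\<close>

lemma abs_integral_le_of_nn_integral_le: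
  fixes u :: "'a \<Rightarrow> real"
  assumes [measurable]: "u \<in> borel_measurable M" and "\<And>x. x \<in> space M \<Longrightarrow> \<bar>u x\<bar> \<le> d x"
    and "(\<integral>\<^sup>+x. ennreal (d x) \<partial>M) \<le> ennreal c" "0 \<le> c"
  shows "integrable M u" "\<bar>integral\<^sup>L M u\<bar> \<le> c"
proof -
  have le: "(\<integral>\<^sup>+x. ennreal (norm (u x)) \<partial>M) \<le> ennreal c"
    using assms(2) by (intro order_trans[OF nn_integral_mono assms(3)] ennreal_leI) auto
  then show i: "integrable M u"
    unfolding integrable_iff_bounded using ennreal_less_top[of c] by (auto intro: le_less_trans)
  have "ennreal \<bar>integral\<^sup>L M u\<bar> \<le> ennreal c"
    using integral_norm_bound_ennreal[OF i] le by simp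
  then show "\<bar>integral\<^sup>L M u\<bar> \<le> c" using assms(4) by (simp add: ennreal_le_iff)
qed

lemma
  fixes h :: "nat \<Rightarrow> real"
  assumes "finite_measure M" and [measurable]: "c \<in> measurable M (count_space UNIV)"
    and bd: "\<And>w. w \<in> space M \<Longrightarrow> c w < K"
  shows integrable_bounded_nat_code: "integrable M (\<lambda>w. h (c w))"
    and integral_bounded_nat_code:
      "(\<integral>w. h (c w) \<partial>M) = (\<Sum>x<K. h x * measure M {w \<in> space M. c w = x})"
proof -
  interpret finite_measure M by fact
  have eq: "h (c w) = (\<Sum>x<K. h x * indicator {w \<in> space M. c w = x} w)" if "w \<in> space M" for w
  proof -
    have "(\<Sum>x<K. h x * indicator {w \<in> space M. c w = x} w) = (\<Sum>x<K. if x = c w then h x else 0)"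
      using that by (intro sum.cong) (auto simp: indicator_def)
    then show ?thesis using bd[OF that] by simp
  qed
  have i: "integrable M (\<lambda>w. h x * indicator {w \<in> space M. c w = x} w)" for x
    by (intro integrable_mult_right integrable_real_indicator) (auto simp: emeasure_eq_measure)
  show "integrable M (\<lambda>w. h (c w))"
    by (subst Bochner_Integration.integrable_cong[OF refl eq]) (assumption | rule Bochner_Integration.integrable_sum i)+
  have "(\<integral>w. h (c w) \<partial>M) = (\<integral>w. (\<Sum>x<K. h x * indicator {w \<in> space M. c w = x} w) \<partial>M)"
    by (intro Bochner_Integration.integral_cong eq refl)
  also have "\<dots> = (\<Sum>x<K. h x * measure M {w \<in> space M. c w = x})"
    by (subst Bochner_Integration.integral_sum[OF i]) (simp add: Int_absorb2 subset_eq)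
  finally show "(\<integral>w. h (c w) \<partial>M) = (\<Sum>x<K. h x * measure M {w \<in> space M. c w = x})" .
qed

lemma nn_integral_bounded_nat_code:
  fixes h :: "nat \<Rightarrow> real"
  assumes "finite_measure M" "c \<in> measurable M (count_space UNIV)"
    and "\<And>w. w \<in> space M \<Longrightarrow> c w < K" and "\<And>x. 0 \<le> h x"
  shows "(\<integral>\<^sup>+w. ennreal (h (c w)) \<partial>M) = ennreal (\<Sum>x<K. h x * measure M {w \<in> space M. c w = x})"
  using nn_integral_eq_integral[OF integrable_bounded_nat_code[OF assms(1-3), of h]]
    integral_bounded_nat_code[OF assms(1-3), of h] assms(4) by simp

text \<open>
  The integer with digits \<open>g 0, \<dots>, g (k - 1)\<close>, most significant first, in the mixed radix system
  with bases \<open>N i\<close>. Its order is the lexicographic order of the digit strings, so that the strings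
  extending a given one form an interval.
\<close>

primrec mixed_radix :: "(nat \<Rightarrow> nat) \<Rightarrow> (nat \<Rightarrow> nat) \<Rightarrow> nat \<Rightarrow> nat" where
  "mixed_radix N g 0 = 0"
| "mixed_radix N g (Suc k) = mixed_radix N g k * N k + g k"

lemma mixed_radix_less:
  assumes "\<And>k. g k < N k"
  shows "mixed_radix N g k < (\<Prod>i<k. N i)"
proof (induction k)
  case (Suc k)
  have "mixed_radix N g (Suc k) < (mixed_radix N g k + 1) * N k" using assms[of k] by simp
  also have "\<dots> \<le> (\<Prod>i<k. N i) * N k" using Suc by (intro mult_right_mono) auto
  finally show ?case by simp
qed simp

text \<open>
  This makes distribution functions of codes consistent: the one of level \<open>k + 1\<close> at
  \<open>x * N k\<close> equals the one of level \<open>k\<close> at \<open>x\<close>.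
\<close>

lemma mixed_radix_Suc_less_iff:
  assumes "g k < N k"
  shows "mixed_radix N g (Suc k) < x * N k \<longleftrightarrow> mixed_radix N g k < x"
proof -
  have "mixed_radix N g (Suc k) div N k = mixed_radix N g k" using assms by simp
  then show ?thesis using assms by (metis div_less_iff_less_mult gr_zeroI not_less_zero)
qed

lemma dist_le_sum_dist_Suc:
  fixes T :: "nat \<Rightarrow> 'z::metric_space"
  shows "dist (T k) (T (j + k)) \<le> (\<Sum>i<j. dist (T (i + k)) (T (Suc (i + k))))"
proof (induction j)
  case (Suc j)
  then show ?case using dist_triangle[of "T k" "T (Suc j + k)" "T (j + k)"] by simp
qed simp

lemma dist_le_suminf_dist_Suc:
  fixes T :: "nat \<Rightarrow> 'z::metric_space"
  assumes "T \<longlonglongrightarrow> l"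
  shows "ennreal (dist (T k) l) \<le> (\<Sum>i. ennreal (dist (T (i + k)) (T (Suc (i + k)))))"
proof (rule LIMSEQ_le_const2)
  show "(\<lambda>j. ennreal (dist (T k) (T (j + k)))) \<longlonglongrightarrow> ennreal (dist (T k) l)"
    using LIMSEQ_ignore_initial_segment[OF assms, of k] by (intro tendsto_ennrealI tendsto_intros)
  have "ennreal (dist (T k) (T (j + k))) \<le> (\<Sum>i<j. ennreal (dist (T (i + k)) (T (Suc (i + k)))))" for j
    by (subst sum_ennreal) (auto intro: ennreal_leI dist_le_sum_dist_Suc)
  then show "\<exists>n0. \<forall>j\<ge>n0. ennreal (dist (T k) (T (j + k))) \<le> (\<Sum>i. ennreal (dist (T (i + k)) (T (Suc (i + k)))))"
    using order_trans[OF _ sum_le_suminf] by (metis finite_lessThan summableI zero_le)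
qed

lemma Cauchy_if_suminf_dist_finite:
  fixes T :: "nat \<Rightarrow> 'z::metric_space"
  assumes "(\<Sum>i. ennreal (dist (T i) (T (Suc i)))) < \<infinity>"
  shows "Cauchy T"
proof (rule metric_CauchyI)
  fix \<epsilon> :: real assume "\<epsilon> > 0"
  have sm: "summable (\<lambda>i. dist (T i) (T (Suc i)))"
    using assms by (intro summable_suminf_not_top) auto
  obtain k where k: "\<And>n. n \<ge> k \<Longrightarrow> norm (\<Sum>i. dist (T (i + n)) (T (Suc (i + n)))) < \<epsilon>/2"
    using suminf_exist_split[OF half_gt_zero[OF \<open>\<epsilon> > 0\<close>] sm] by auto
  have "dist (T k) (T (j + k)) < \<epsilon>/2" for j
  proof -
    have "dist (T k) (T (j + k)) \<le> (\<Sum>i<j. dist (T (i + k)) (T (Suc (i + k))))"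
      by (rule dist_le_sum_dist_Suc)
    also have "\<dots> \<le> (\<Sum>i. dist (T (i + k)) (T (Suc (i + k))))"
      using summable_ignore_initial_segment[OF sm, of k] by (intro sum_le_suminf) auto
    also have "\<dots> < \<epsilon>/2" using k[of k] by simp
    finally show ?thesis .
  qed
  then have "dist (T k) (T n) < \<epsilon>/2" if "n \<ge> k" for n using that by (metis le_add_diff_inverse2)
  then have "dist (T m) (T n) < \<epsilon>" if "m \<ge> k" "n \<ge> k" for m n
    using that dist_triangle_half_r by blast
  then show "\<exists>M. \<forall>m\<ge>M. \<forall>n\<ge>M. dist (T m) (T n) < \<epsilon>" by blast
qed

text \<open>
  Convergence in the Kantorovich--Rubinstein norm, for positive measures: convergence of the
  masses and of the integrals, uniformly over the functions in the supremum of the norm.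
\<close>

definition KR_converges :: "'z::metric_space \<Rightarrow> (nat \<Rightarrow> 'z measure) \<Rightarrow> 'z measure \<Rightarrow> bool" where
  "KR_converges e P Q \<longleftrightarrow>
     (\<lambda>n. measure (P n) UNIV) \<longlonglongrightarrow> measure Q UNIV \<and>
     (\<forall>\<epsilon>>0. eventually (\<lambda>n. \<forall>f :: 'z \<Rightarrow> real. f e = 0 \<longrightarrow> 1-lipschitz_on UNIV f \<longrightarrow>
        \<bar>integral\<^sup>L (P n) f - integral\<^sup>L Q f\<bar> \<le> \<epsilon>) sequentially)"

lemma measure_restrict_lborel_interval:
  assumes "0 \<le> a" "a \<le> b" "b \<le> m"
  shows "measure (restrict_space lborel {0..<m::real}) {a..<b} = b - a"
  using assms by (subst measure_restrict_space) auto

text \<open>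
  Let the code of level \<open>k\<close> list the values of \<open>r 0, \<dots>, r (k - 1)\<close> as one integer. After passing
  to a subsequence, the distribution functions \<open>F k\<close> of all codes converge. On \<open>[0, m)\<close>, with \<open>m\<close> the
  limit mass, their inverses \<open>b k\<close> have the limit law of the codes, and \<open>b k\<close> is a function of
  \<open>b (k + 1)\<close> exactly as for the codes themselves. Decoding the last digit gives \<open>T k : [0, m) \<rightarrow> Z\<close>, and
  the joint law of \<open>T k\<close> and \<open>T (k + 1)\<close> is the limit of the joint laws of \<open>r k\<close> and
  \<open>r (k + 1)\<close>. Since the latter two are close in mean, so are the former two; thus \<open>T k\<close> converges in
  mean and almost everywhere, and the limit measure is the law of the limit function.

  For a 1-Lipschitz function the integrals against the \<open>n\<close>-th measure and against the limit are
  compared through level \<open>k\<close>: quantizing costs \<open>2\<^sup>-\<^sup>k\<close> on one side and \<open>4 * 2\<^sup>-\<^sup>k\<close> on the other, and the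
  rest is a finite sum whose weights converge, with coefficients bounded independently of the
  function.
\<close>

theorem KR_compact_of_quantizers:
  fixes P :: "nat \<Rightarrow> 'z::polish_space measure" and r :: "nat \<Rightarrow> 'z \<Rightarrow> 'z"
  assumes P: "\<And>n. finite_first_moment e (P n)" and mass: "\<And>n. measure (P n) UNIV \<le> C"
    and r_fin: "\<And>k. finite (range (r k))" and r_meas: "\<And>k. r k \<in> borel_measurable borel"
    and close: "\<And>k n. (\<integral>\<^sup>+z. ennreal (dist z (r k z)) \<partial>P n) \<le> ennreal ((1/2)^k)"
  obtains s Q where "strict_mono s" "finite_first_moment e Q" "KR_converges e (P \<circ> s) Q"
proof -
  note PD = finite_first_momentD[OF P]
  note [measurable_cong] = PD(1)
  note [measurable] = r_meas
  have spP [simp]: "space (P n) = UNIV" for n using sets_eq_imp_space_eq[OF PD(1)] by simp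
  define N where "N k = card (range (r k))" for k
  define g where "g k z = to_nat_on (range (r k)) (r k z)" for k z
  have g_less: "g k z < N k" for k z
    using bij_betw_apply[OF to_nat_on_finite[OF r_fin], of "r k z" k] by (simp add: g_def N_def)
  have N_pos: "N k > 0" for k using g_less[of k undefined] by linarith
  define code where "code k z = mixed_radix N (\<lambda>k. g k z) k" for k z
  define K where "K k = (\<Prod>i<k. N i)" for k
  define R where "R k x = from_nat_into (range (r k)) (x mod N k)" for k x
  have code_less: "code k z < K k" for k z unfolding code_def K_def using g_less by (rule mixed_radix_less)
  have code_div: "code (Suc k) z div N k = code k z" for k z
    unfolding code_def using g_less[of k z] by simp
  have r_R: "r k z = R k (code (Suc k) z)" for k z
    using g_less[of k z] by (simp add: R_def code_def)
      (simp add: g_def from_nat_into_to_nat_on countable_finite[OF r_fin])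
  have g_meas [measurable]: "g k \<in> measurable borel (count_space UNIV)" for k
  proof -
    have "g k -` {a} \<in> sets borel" for a
    proof -
      have "g k -` {a} = r k -` {y \<in> range (r k). to_nat_on (range (r k)) y = a} \<inter> space borel"
        by (auto simp: g_def)
      moreover have "closed {y \<in> range (r k). to_nat_on (range (r k)) y = a}"
        using r_fin by (intro finite_imp_closed) auto
      ultimately show ?thesis
        using measurable_sets[OF r_meas[of k], of "{y \<in> range (r k). to_nat_on (range (r k)) y = a}"] by simp
    qed
    then show ?thesis by (simp add: measurable_count_space_eq2_countable)
  qed
  have code_meas [measurable]: "code k \<in> measurable borel (count_space UNIV)" for k
    unfolding code_def by (induction k) simp_all
  \<comment> \<open>One subsequence along which the distribution functions of the codes of all levels converge.\<close>
  define Fn where "Fn n = (\<lambda>(k, x). measure (P n) {z. code k z < x})" for n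
  have "norm (Fn n kx) \<le> C" for n kx
  proof -
    interpret finite_measure "P n" by (rule PD)
    have "Fn n kx \<le> measure (P n) UNIV" unfolding Fn_def
      by (cases kx) (auto intro!: finite_measure_mono)
    then show ?thesis using mass[of n] by (auto simp: Fn_def split: prod.splits)
  qed
  then obtain s where s: "strict_mono (s :: nat \<Rightarrow> nat)" "\<And>kx. \<exists>l. (\<lambda>n. Fn (s n) kx) \<longlonglongrightarrow> l"
    by - (rule function_convergent_subsequence[of "UNIV :: (nat \<times> nat) set" Fn C], auto)
  define F where "F k x = lim (\<lambda>n. Fn (s n) (k, x))" for k x
  have F_lim: "(\<lambda>n. measure (P (s n)) {z. code k z < x}) \<longlonglongrightarrow> F k x" for k x
    using s(2)[of "(k, x)"] unfolding F_def Fn_def by (simp add: convergent_def convergent_LIMSEQ_iff[symmetric])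
  have F_0: "F k 0 = 0" for k using F_lim[of k 0] by (simp add: LIMSEQ_const_iff)
  have F_mono: "F k x \<le> F k y" if "x \<le> y" for k x y
  proof (rule LIMSEQ_le[OF F_lim[of k x] F_lim[of k y]], intro exI allI impI)
    fix n
    interpret finite_measure "P (s n)" by (rule PD)
    show "measure (P (s n)) {z. code k z < x} \<le> measure (P (s n)) {z. code k z < y}"
      using that by (intro finite_measure_mono) auto
  qed
  have F_Suc: "F (Suc k) (x * N k) = F k x" for k x
  proof -
    have "mixed_radix N (\<lambda>k. g k z) (Suc k) < x * N k \<longleftrightarrow> mixed_radix N (\<lambda>k. g k z) k < x" for z
      by (rule mixed_radix_Suc_less_iff) (rule g_less)
    then have "{z. code (Suc k) z < x * N k} = {z. code k z < x}" by (simp only: code_def)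
    then show ?thesis using F_lim[of "Suc k" "x * N k"] F_lim[of k x] LIMSEQ_unique by simp
  qed
  define m where "m = F 0 1"
  have F_top: "F k (K k) = m" for k
  proof -
    have "{z. code k z < K k} = {z. code 0 z < 1}" using code_less by (auto simp: code_def)
    then show ?thesis using F_lim[of k "K k"] F_lim[of 0 1] LIMSEQ_unique by (simp add: m_def)
  qed
  have m_lim: "(\<lambda>n. measure (P (s n)) UNIV) \<longlonglongrightarrow> m"
    using F_lim[of 0 1] by (simp add: m_def code_def)
  \<comment> \<open>The generalized inverse \<open>b k\<close> of \<open>F k\<close> has as its law the limit law of the codes of level \<open>k\<close>.\<close>
  define \<Omega> where "\<Omega> = restrict_space lborel {0..<m}"
  have sp\<Omega>: "space \<Omega> = {0..<m}" by (simp add: \<Omega>_def space_restrict_space)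
  have m_nonneg: "0 \<le> m" using F_mono[of 0 1 0] F_0[of 0] by (simp add: m_def)
  then have fin\<Omega>: "finite_measure \<Omega>" unfolding \<Omega>_def
    by (intro finite_measureI) (simp_all add: emeasure_restrict_space space_restrict_space)
  interpret \<Omega>: finite_measure \<Omega> by (rule fin\<Omega>)
  define b where "b k t = (LEAST x. t < F k (Suc x))" for k t
  have b_meas [measurable]: "b k \<in> measurable \<Omega> (count_space UNIV)" for k
    unfolding b_def \<Omega>_def by (rule measurable_restrict_space1) measurable
  have b_iff: "b k t = x \<longleftrightarrow> F k x \<le> t \<and> t < F k (Suc x)" if t: "t \<in> {0..<m}" for k t x
  proof -
    have ex: "t < F k (Suc (K k))" using t F_mono[of "K k" "Suc (K k)" k] F_top[of k] by simp
    have 1: "t < F k (Suc (b k t))" unfolding b_def by (rule LeastI[of "\<lambda>x. t < F k (Suc x)", OF ex])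
    have 2: "F k (b k t) \<le> t"
    proof (cases "b k t")
      case 0 then show ?thesis using t F_0 by simp
    next
      case (Suc y)
      then have "y < b k t" by simp
      then have "\<not> t < F k (Suc y)" unfolding b_def by (rule not_less_Least)
      then show ?thesis using Suc by simp
    qed
    show ?thesis
    proof
      assume a: "F k x \<le> t \<and> t < F k (Suc x)"
      have "\<not> Suc (b k t) \<le> x" using F_mono[of "Suc (b k t)" x k] 1 a by linarith
      moreover have "\<not> Suc x \<le> b k t" using F_mono[of "Suc x" "b k t" k] 2 a by linarith
      ultimately show "b k t = x" by simp
    qed (use 1 2 in auto)
  qed
  have b_less: "b k t < K k" if t: "t \<in> {0..<m}" for k t
    using b_iff[OF t, of k "b k t"] F_mono[of "K k" "b k t" k] F_top[of k] t by force
  have b_div: "b (Suc k) t div N k = b k t" if t: "t \<in> {0..<m}" for k t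
  proof -
    let ?y = "b (Suc k) t" let ?x = "?y div N k"
    have y: "F (Suc k) ?y \<le> t" "t < F (Suc k) (Suc ?y)" using b_iff[OF t] by blast+
    have "F (Suc k) (?x * N k) \<le> F (Suc k) ?y" by (rule F_mono) simp
    moreover have "F (Suc k) (Suc ?y) \<le> F (Suc k) (Suc ?x * N k)"
      using dividend_less_div_times[OF N_pos[of k], of ?y] by (intro F_mono) simp
    ultimately have "F k ?x \<le> t" "t < F k (Suc ?x)" using y unfolding F_Suc by linarith+
    then have "b k t = ?x" using b_iff[OF t] by blast
    then show ?thesis by simp
  qed
  define p where "p n k x = measure (P (s n)) {z \<in> space (P (s n)). code k z = x}" for n k x
  define q where "q k x = measure \<Omega> {t \<in> space \<Omega>. b k t = x}" for k x
  have pq: "(\<lambda>n. p n k x) \<longlonglongrightarrow> q k x" if "x < K k" for k x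
  proof -
    have bx: "0 \<le> F k x" "F k (Suc x) \<le> m"
      using F_mono[of "Suc x" "K k" k] F_mono[of 0 x k] F_0[of k] F_top[of k] that by auto
    have eq: "{t \<in> space \<Omega>. b k t = x} = {F k x..<F k (Suc x)}"
    proof (rule set_eqI)
      fix t show "t \<in> {t \<in> space \<Omega>. b k t = x} \<longleftrightarrow> t \<in> {F k x..<F k (Suc x)}"
      proof (cases "t \<in> {0..<m}")
        case True then show ?thesis using b_iff[OF True, of k x] by (simp add: sp\<Omega>)
      qed (use bx in \<open>auto simp: sp\<Omega>\<close>)
    qed
    have "q k x = F k (Suc x) - F k x" unfolding q_def eq unfolding \<Omega>_def
      using bx F_mono[of x "Suc x" k]
      by (intro measure_restrict_lborel_interval) auto
    moreover have "p n k x = measure (P (s n)) {z. code k z < Suc x} - measure (P (s n)) {z. code k z < x}" for n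
    proof -
      interpret finite_measure "P (s n)" by (rule PD)
      have "measure (P (s n)) ({z. code k z < Suc x} - {z. code k z < x})
          = measure (P (s n)) {z. code k z < Suc x} - measure (P (s n)) {z. code k z < x}"
        by (rule finite_measure_Diff) auto
      moreover have "{z. code k z < Suc x} - {z. code k z < x} = {z. code k z = x}" by auto
      ultimately show ?thesis by (simp add: p_def)
    qed
    ultimately show ?thesis using tendsto_diff[OF F_lim[of k "Suc x"] F_lim[of k x]] by simp
  qed
  define T where "T k t = R k (b (Suc k) t)" for k t
  have T_meas [measurable]: "T k \<in> borel_measurable \<Omega>" for k
    unfolding T_def by (rule measurable_compose[OF b_meas]) simp
  have T_close: "(\<integral>\<^sup>+t. ennreal (dist (T k t) (T (Suc k) t)) \<partial>\<Omega>) \<le> ennreal (2 * (1/2)^k)" for k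
  proof -
    \<comment> \<open>Both \<open>r k\<close> and \<open>r (k + 1)\<close> are functions of the code of level \<open>k + 2\<close>, and \<open>T k\<close>, \<open>T (k + 1)\<close> are the
      same functions of \<open>b (k + 2)\<close>.\<close>
    define h where "h x = dist (R k (x div N (Suc k))) (R (Suc k) x)" for x
    have "(\<integral>\<^sup>+t. ennreal (dist (T k t) (T (Suc k) t)) \<partial>\<Omega>) = (\<integral>\<^sup>+t. ennreal (h (b (Suc (Suc k)) t)) \<partial>\<Omega>)"
      by (intro nn_integral_cong) (simp add: h_def T_def b_div sp\<Omega>)
    also have "\<dots> = ennreal (\<Sum>x<K (Suc (Suc k)). h x * q (Suc (Suc k)) x)"
      unfolding q_def using b_less
      by (intro nn_integral_bounded_nat_code fin\<Omega> b_meas) (auto simp: h_def sp\<Omega>)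
    also have "\<dots> \<le> ennreal (2 * (1/2)^k)"
    proof (rule ennreal_leI, rule LIMSEQ_le_const2)
      show "(\<lambda>n. \<Sum>x<K (Suc (Suc k)). h x * p n (Suc (Suc k)) x) \<longlonglongrightarrow> (\<Sum>x<K (Suc (Suc k)). h x * q (Suc (Suc k)) x)"
        by (intro tendsto_intros pq) auto
      have "(\<Sum>x<K (Suc (Suc k)). h x * p n (Suc (Suc k)) x) \<le> 2 * (1/2)^k" for n
      proof -
        have "ennreal (\<Sum>x<K (Suc (Suc k)). h x * p n (Suc (Suc k)) x)
            = (\<integral>\<^sup>+z. ennreal (h (code (Suc (Suc k)) z)) \<partial>P (s n))"
          unfolding p_def using code_less
          by (intro nn_integral_bounded_nat_code[symmetric] PD) (auto simp: h_def)
        also have "\<dots> = (\<integral>\<^sup>+z. ennreal (dist (r k z) (r (Suc k) z)) \<partial>P (s n))"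
          by (intro nn_integral_cong) (simp add: h_def r_R code_div)
        also have "\<dots> \<le> (\<integral>\<^sup>+z. ennreal (dist z (r k z)) + ennreal (dist z (r (Suc k) z)) \<partial>P (s n))"
          by (intro nn_integral_mono) (auto simp: dist_triangle3 simp flip: ennreal_plus intro!: ennreal_leI)
        also have "\<dots> = (\<integral>\<^sup>+z. ennreal (dist z (r k z)) \<partial>P (s n)) + (\<integral>\<^sup>+z. ennreal (dist z (r (Suc k) z)) \<partial>P (s n))"
          by (rule nn_integral_add) measurable
        also have "\<dots> \<le> ennreal ((1/2)^k) + ennreal ((1/2)^(Suc k))"
          by (intro add_mono close)
        also have "\<dots> \<le> ennreal (2 * (1/2)^k)" by (simp flip: ennreal_plus)
        finally show ?thesis by (subst (asm) ennreal_le_iff) auto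
      qed
      then show "\<exists>n0. \<forall>n\<ge>n0. (\<Sum>x<K (Suc (Suc k)). h x * p n (Suc (Suc k)) x) \<le> 2 * (1/2)^k" by blast
    qed
    finally show ?thesis .
  qed
  have tail: "(\<Sum>i. \<integral>\<^sup>+t. ennreal (dist (T (i + k) t) (T (Suc (i + k)) t)) \<partial>\<Omega>) \<le> ennreal (4 * (1/2)^k)" for k
  proof -
    have "(\<Sum>i. \<integral>\<^sup>+t. ennreal (dist (T (i + k) t) (T (Suc (i + k)) t)) \<partial>\<Omega>) \<le> (\<Sum>i. ennreal (2 * (1/2)^k * (1/2)^i))"
    proof (intro suminf_le)
      fix i show "(\<integral>\<^sup>+t. ennreal (dist (T (i + k) t) (T (Suc (i + k)) t)) \<partial>\<Omega>) \<le> ennreal (2 * (1/2)^k * (1/2)^i)"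
        using T_close[of "i + k"] by (simp only: power_add mult_ac)
    qed auto
    also have "\<dots> = ennreal (2 * (1/2)^k * (1 / (1 - 1/2)))"
      by (intro suminf_ennreal_eq sums_mult geometric_sums) auto
    finally show ?thesis by simp
  qed
  define G where "G = {t \<in> space \<Omega>. (\<Sum>i. ennreal (dist (T i t) (T (Suc i) t))) < \<infinity>}"
  have G_meas [measurable]: "G \<in> sets \<Omega>" unfolding G_def by measurable
  have AE_G: "AE t in \<Omega>. t \<in> G"
  proof -
    have "(\<integral>\<^sup>+t. (\<Sum>i. ennreal (dist (T i t) (T (Suc i) t))) \<partial>\<Omega>) \<le> ennreal 4"
      using tail[of 0] by (subst nn_integral_suminf) auto
    then have "AE t in \<Omega>. (\<Sum>i. ennreal (dist (T i t) (T (Suc i) t))) \<noteq> \<infinity>"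
      by (intro nn_integral_noteq_infinite) (auto simp: top_unique)
    then show ?thesis using AE_space by eventually_elim (auto simp: G_def less_top)
  qed
  \<comment> \<open>Off the null set where convergence may fail, the value \<open>e\<close> keeps the limit measurable.\<close>
  define T' where "T' k t = (if t \<in> G then T k t else e)" for k t
  have T'_meas [measurable]: "T' k \<in> borel_measurable \<Omega>" for k unfolding T'_def by measurable
  define TL where "TL t = lim (\<lambda>k. T' k t)" for t
  have T'_lim: "(\<lambda>k. T' k t) \<longlonglongrightarrow> TL t" for t
  proof -
    have "convergent (\<lambda>k. T' k t)"
    proof (cases "t \<in> G")
      case True
      then have "Cauchy (\<lambda>i. T i t)" by (intro Cauchy_if_suminf_dist_finite) (simp add: G_def)
      then have "convergent (\<lambda>i. T i t)" by (rule Cauchy_convergent)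
      then show ?thesis using True by (simp only: T'_def if_True)
    next
      case False
      then show ?thesis by (simp only: T'_def if_False convergent_const)
    qed
    then show ?thesis unfolding TL_def by (simp add: convergent_LIMSEQ_iff)
  qed
  have TL_meas [measurable]: "TL \<in> borel_measurable \<Omega>"
    by (rule borel_measurable_LIMSEQ_metric[OF T'_meas]) (rule T'_lim)
  have TL_close: "(\<integral>\<^sup>+t. ennreal (dist (T k t) (TL t)) \<partial>\<Omega>) \<le> ennreal (4 * (1/2)^k)" for k
  proof -
    have "AE t in \<Omega>. ennreal (dist (T k t) (TL t)) \<le> (\<Sum>i. ennreal (dist (T (i + k) t) (T (Suc (i + k)) t)))"
      using AE_G
    proof eventually_elim
      case (elim t)
      then have "(\<lambda>k. T k t) \<longlonglongrightarrow> TL t" using T'_lim[of t] by (simp add: T'_def)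
      then show ?case by (rule dist_le_suminf_dist_Suc)
    qed
    then have "(\<integral>\<^sup>+t. ennreal (dist (T k t) (TL t)) \<partial>\<Omega>)
        \<le> (\<integral>\<^sup>+t. (\<Sum>i. ennreal (dist (T (i + k) t) (T (Suc (i + k)) t))) \<partial>\<Omega>)"
      by (rule nn_integral_mono_AE)
    also have "\<dots> = (\<Sum>i. \<integral>\<^sup>+t. ennreal (dist (T (i + k) t) (T (Suc (i + k)) t)) \<partial>\<Omega>)"
      by (rule nn_integral_suminf) measurable
    also have "\<dots> \<le> ennreal (4 * (1/2)^k)" by (rule tail)
    finally show ?thesis .
  qed
  define Q where "Q = distr \<Omega> borel TL"
  have Q: "finite_first_moment e Q"
    unfolding finite_first_moment_def
  proof (intro conjI)
    show "sets Q = sets borel" by (simp add: Q_def)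
    show "finite_measure Q" unfolding Q_def by (rule \<Omega>.finite_measure_distr) simp
    have "(\<integral>\<^sup>+z. ennreal (dist z e) \<partial>Q) = (\<integral>\<^sup>+t. ennreal (dist (TL t) e) \<partial>\<Omega>)"
      unfolding Q_def by (rule nn_integral_distr) simp_all
    also have "\<dots> \<le> (\<integral>\<^sup>+t. ennreal (dist (T 0 t) (TL t)) + ennreal (dist (T 0 t) e) \<partial>\<Omega>)"
      by (intro nn_integral_mono) (auto simp: dist_triangle3 simp flip: ennreal_plus intro!: ennreal_leI)
    also have "\<dots> = (\<integral>\<^sup>+t. ennreal (dist (T 0 t) (TL t)) \<partial>\<Omega>) + (\<integral>\<^sup>+t. ennreal (dist (T 0 t) e) \<partial>\<Omega>)"
      by (rule nn_integral_add) measurable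
    also have "\<dots> < \<infinity>"
    proof -
      have "(\<integral>\<^sup>+t. ennreal (dist (T 0 t) e) \<partial>\<Omega>) = ennreal (\<Sum>x<K 1. dist (R 0 x) e * q 1 x)"
        unfolding T_def q_def using b_less
        by (subst nn_integral_bounded_nat_code[OF fin\<Omega> b_meas, where h="\<lambda>x. dist (R 0 x) e" and K="K 1"])
          (auto simp: sp\<Omega>)
      moreover have "(\<integral>\<^sup>+t. ennreal (dist (T 0 t) (TL t)) \<partial>\<Omega>) < \<infinity>"
        using TL_close[of 0] ennreal_less_top le_less_trans by fastforce
      ultimately show ?thesis by (simp add: ennreal_add_less_top)
    qed
    finally show "(\<integral>\<^sup>+z. ennreal (dist z e) \<partial>Q) < \<infinity>" .
  qed
  have key: "\<bar>integral\<^sup>L (P (s n)) f - integral\<^sup>L Q f\<bar>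
      \<le> 5 * (1/2)^k + (\<Sum>x<K (Suc k). dist (R k x) e * \<bar>p n (Suc k) x - q (Suc k) x\<bar>)"
    if f: "f e = 0" "1-lipschitz_on UNIV f" for f :: "'z \<Rightarrow> real" and n k
  proof -
    note [measurable] = lipschitz_on_UNIV_borel_measurable[OF f(2)]
    have f_lip: "\<bar>f x - f y\<bar> \<le> dist x y" for x y
      using lipschitz_onD[OF f(2), of x y] by (simp add: dist_real_def)
    have iP: "integrable (P (s n)) f" by (rule finite_first_moment_integrable_lipschitz[OF P f(2)])
    have 1: "integrable (P (s n)) (\<lambda>z. f z - f (r k z))" "\<bar>\<integral>z. f z - f (r k z) \<partial>P (s n)\<bar> \<le> (1/2)^k"
    proof -
      have "(\<lambda>z. f z - f (r k z)) \<in> borel_measurable (P (s n))" by measurable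
      note abs_integral_le_of_nn_integral_le[OF this f_lip close]
      then show "integrable (P (s n)) (\<lambda>z. f z - f (r k z))" "\<bar>\<integral>z. f z - f (r k z) \<partial>P (s n)\<bar> \<le> (1/2)^k"
        by simp_all
    qed
    have iPr: "integrable (P (s n)) (\<lambda>z. f (r k z))"
      using Bochner_Integration.integrable_diff[OF iP 1(1)] by simp
    have 2: "(\<integral>z. f (r k z) \<partial>P (s n)) = (\<Sum>x<K (Suc k). f (R k x) * p n (Suc k) x)"
      unfolding r_R p_def using code_less
      by (intro integral_bounded_nat_code PD) (auto simp: sp\<Omega>)
    have 3: "integrable \<Omega> (\<lambda>t. f (T k t))" "(\<integral>t. f (T k t) \<partial>\<Omega>) = (\<Sum>x<K (Suc k). f (R k x) * q (Suc k) x)"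
      unfolding T_def q_def using b_less
      by (intro integral_bounded_nat_code integrable_bounded_nat_code[where K="K (Suc k)"] fin\<Omega> b_meas; simp add: sp\<Omega>)+
    have 4: "integrable \<Omega> (\<lambda>t. f (T k t) - f (TL t))" "\<bar>\<integral>t. f (T k t) - f (TL t) \<partial>\<Omega>\<bar> \<le> 4 * (1/2)^k"
    proof -
      have "(\<lambda>t. f (T k t) - f (TL t)) \<in> borel_measurable \<Omega>" by measurable
      note abs_integral_le_of_nn_integral_le[OF this f_lip TL_close]
      then show "integrable \<Omega> (\<lambda>t. f (T k t) - f (TL t))" "\<bar>\<integral>t. f (T k t) - f (TL t) \<partial>\<Omega>\<bar> \<le> 4 * (1/2)^k"
        by simp_all
    qed
    have 5: "integrable \<Omega> (\<lambda>t. f (TL t))"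
      using Bochner_Integration.integrable_diff[OF 3(1) 4(1)] by simp
    have 6: "integral\<^sup>L Q f = (\<integral>t. f (TL t) \<partial>\<Omega>)"
      unfolding Q_def by (rule integral_distr) simp_all
    have "\<bar>(\<Sum>x<K (Suc k). f (R k x) * p n (Suc k) x) - (\<Sum>x<K (Suc k). f (R k x) * q (Suc k) x)\<bar>
        \<le> (\<Sum>x<K (Suc k). \<bar>f (R k x) * (p n (Suc k) x - q (Suc k) x)\<bar>)"
      unfolding sum_subtractf[symmetric] right_diff_distrib[symmetric] by (rule sum_abs)
    also have "\<dots> \<le> (\<Sum>x<K (Suc k). dist (R k x) e * \<bar>p n (Suc k) x - q (Suc k) x\<bar>)"
      unfolding abs_mult using f_lip[of _ e] f(1) by (intro sum_mono mult_right_mono) auto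
    finally have 7: "\<bar>(\<integral>z. f (r k z) \<partial>P (s n)) - (\<integral>t. f (T k t) \<partial>\<Omega>)\<bar> \<le> \<dots>"
      unfolding 2 3(2) .
    have "integral\<^sup>L (P (s n)) f - integral\<^sup>L Q f
       = (\<integral>z. f z - f (r k z) \<partial>P (s n)) + ((\<integral>z. f (r k z) \<partial>P (s n)) - (\<integral>t. f (T k t) \<partial>\<Omega>))
         + (\<integral>t. f (T k t) - f (TL t) \<partial>\<Omega>)"
      unfolding 6 by (simp add: Bochner_Integration.integral_diff[OF iP iPr]
          Bochner_Integration.integral_diff[OF 3(1) 5])
    then show ?thesis using 1(2) 4(2) 7 by linarith
  qed
  have "KR_converges e (P \<circ> s) Q"
    unfolding KR_converges_def
  proof (intro conjI allI impI)
    have "measure Q UNIV = m"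
    proof -
      have "measure Q UNIV = measure \<Omega> {0..<m}"
        unfolding Q_def by (subst measure_distr) (auto simp: sp\<Omega>)
      also have "\<dots> = m"
        using F_mono[of 0 1 0] F_0[of 0] by (simp add: \<Omega>_def measure_restrict_lborel_interval m_def)
      finally show ?thesis .
    qed
    then show "(\<lambda>n. measure ((P \<circ> s) n) UNIV) \<longlonglongrightarrow> measure Q UNIV" using m_lim by simp
    fix \<epsilon> :: real assume "\<epsilon> > 0"
    obtain k where k: "(1/2)^k < \<epsilon>/10" using real_arch_pow_inv[of "\<epsilon>/10" "1/2"] \<open>\<epsilon> > 0\<close> by auto
    have "(\<lambda>n. \<Sum>x<K (Suc k). dist (R k x) e * \<bar>p n (Suc k) x - q (Suc k) x\<bar>)
        \<longlonglongrightarrow> (\<Sum>x<K (Suc k). dist (R k x) e * \<bar>q (Suc k) x - q (Suc k) x\<bar>)"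
      by (intro tendsto_intros pq) auto
    then have "eventually (\<lambda>n. (\<Sum>x<K (Suc k). dist (R k x) e * \<bar>p n (Suc k) x - q (Suc k) x\<bar>) < \<epsilon>/2) sequentially"
      using \<open>\<epsilon> > 0\<close> by (intro order_tendstoD) auto
    then show "eventually (\<lambda>n. \<forall>f :: 'z \<Rightarrow> real. f e = 0 \<longrightarrow> 1-lipschitz_on UNIV f \<longrightarrow>
        \<bar>integral\<^sup>L ((P \<circ> s) n) f - integral\<^sup>L Q f\<bar> \<le> \<epsilon>) sequentially"
    proof eventually_elim
      case (elim n)
      show ?case
      proof (intro allI impI)
        fix f :: "'z \<Rightarrow> real" assume "f e = 0" "1-lipschitz_on UNIV f"
        from key[OF this, of n k] elim k show "\<bar>integral\<^sup>L ((P \<circ> s) n) f - integral\<^sup>L Q f\<bar> \<le> \<epsilon>"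
          by simp
      qed
    qed
  qed
  with s(1) Q show thesis by (rule that)
qed

text \<open>
  Inside a large ball, send each point to the first point of a finite \<open>\<delta>\<close>-net that is
  close to it; outside, send it to \<open>e\<close>. The latter moves \<open>z\<close> by \<open>d(z, e)\<close>, which for \<open>p > 1\<close> is at most
  \<open>\<delta> d(z, e)\<^sup>p\<close> as soon as \<open>d(z, e) \<ge> \<rho>\<close>, where \<open>\<rho>\<^sup>p\<^sup>-\<^sup>1 = 1/\<delta>\<close>.
\<close>

lemma exists_quantizer:
  fixes e :: "'z::polish_space"
  assumes proper: "\<And>\<rho>. compact (cball e \<rho>)" and p: "1 < p" and \<delta>: "0 < \<delta>"
  obtains r :: "'z \<Rightarrow> 'z" where "finite (range r)" "r \<in> borel_measurable borel"
    "\<And>z. dist z (r z) \<le> \<delta> * (1 + dist z e powr p)"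
proof -
  define \<rho> where "\<rho> = (1/\<delta>) powr (1/(p - 1))"
  have far: "d \<le> \<delta> * d powr p" if "\<rho> \<le> d" for d
  proof -
    have "0 < \<rho>" using \<delta> by (simp add: \<rho>_def)
    then have d: "0 < d" using that by simp
    have "1/\<delta> = \<rho> powr (p - 1)" using \<delta> p by (simp add: \<rho>_def powr_powr)
    also have "\<dots> \<le> d powr (p - 1)" using that p \<open>0 < \<rho>\<close> by (intro powr_mono2) auto
    finally have "1 \<le> \<delta> * d powr (p - 1)" using \<delta> by (simp add: field_simps)
    then have "d \<le> d * (\<delta> * d powr (p - 1))" using d by simp
    also have "\<dots> = \<delta> * d powr p" using d by (simp add: powr_diff)
    finally show ?thesis .
  qed
  obtain A where A: "finite A" "cball e \<rho> \<subseteq> (\<Union>x\<in>A. ball x \<delta>)"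
    using proper[of \<rho>, unfolded compact_eq_totally_bounded] \<delta> by meson
  obtain xs where xs: "set xs = A" using finite_list[OF A(1)] by blast
  define i where "i z = (LEAST j. j < length xs \<and> dist (xs ! j) z < \<delta>)" for z
  define r where "r z = (if z \<in> cball e \<rho> then xs ! i z else e)" for z
  have i: "i z < length xs \<and> dist (xs ! i z) z < \<delta>" if z: "z \<in> cball e \<rho>" for z
  proof -
    obtain x where "x \<in> set xs" "dist x z < \<delta>" using subsetD[OF A(2) z] xs by auto
    then have "\<exists>j. j < length xs \<and> dist (xs ! j) z < \<delta>" by (metis in_set_conv_nth)
    then show ?thesis unfolding i_def by (rule LeastI_ex)
  qed
  show thesis
  proof
    have "range r \<subseteq> insert e (set xs)" using i by (auto simp: r_def)
    then show "finite (range r)" by (rule finite_subset) simp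
    have [measurable]: "i \<in> measurable borel (count_space UNIV)" unfolding i_def by measurable
    have "(\<lambda>z. xs ! i z) \<in> borel_measurable borel"
      by (rule measurable_compose[of i _ "count_space UNIV"]) simp_all
    moreover have "cball e \<rho> \<in> sets borel" by simp
    ultimately show "r \<in> borel_measurable borel" unfolding r_def
      by (intro measurable_If_set) simp_all
    fix z
    show "dist z (r z) \<le> \<delta> * (1 + dist z e powr p)"
    proof (cases "z \<in> cball e \<rho>")
      case True
      then have "dist z (r z) \<le> \<delta> * 1" using i[OF True] by (simp add: r_def dist_commute less_imp_le)
      also have "\<dots> \<le> \<delta> * (1 + dist z e powr p)" using \<delta> by (intro mult_left_mono) auto
      finally show ?thesis .
    next
      case False
      then have "dist z e \<le> \<delta> * dist z e powr p" by (intro far) (simp add: dist_commute)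
      moreover have "r z = e" using False by (simp add: r_def)
      ultimately show ?thesis using \<delta> by (simp add: distrib_left)
    qed
  qed
qed

lemma le_one_plus_powr:
  fixes d :: real
  assumes "0 \<le> d" "1 \<le> p"
  shows "d \<le> 1 + d powr p"
proof (cases "d \<le> 1")
  case False
  then have "d powr 1 \<le> d powr p" using assms by (intro powr_mono) auto
  then show ?thesis using False by simp
qed (simp add: add_increasing2)

lemma borel_measurable_dist_powr [measurable]:
  fixes e :: "'z::metric_space"
  shows "(\<lambda>z. dist z e powr p) \<in> borel_measurable borel"
proof -
  have [measurable]: "(\<lambda>z. dist z e) \<in> borel_measurable borel"
    by (intro borel_measurable_continuous_onI continuous_intros)
  show ?thesis by measurable
qed

lemma
  fixes e :: "'z::metric_space"
  assumes M: "sets M = sets borel" and p: "1 \<le> p" and C: "0 \<le> C"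
    and le: "(\<integral>\<^sup>+z. ennreal (1 + dist z e powr p) \<partial>M) \<le> ennreal C"
  shows finite_first_moment_of_moment: "finite_first_moment e M"
    and mass_le_moment: "measure M UNIV \<le> C"
proof -
  have "emeasure M UNIV = (\<integral>\<^sup>+z. 1 \<partial>M)" using sets_eq_imp_space_eq[OF M] by simp
  also have "\<dots> \<le> (\<integral>\<^sup>+z. ennreal (1 + dist z e powr p) \<partial>M)"
    by (intro nn_integral_mono) (simp add: ennreal_1[symmetric] del: ennreal_1)
  finally have mass: "emeasure M UNIV \<le> ennreal C" using le by simp
  then show "measure M UNIV \<le> C" using C by (simp add: measure_def enn2real_leI)
  have "finite_measure M" using mass M
    by (intro finite_borel_measureI) (auto intro: le_less_trans)
  moreover have "(\<integral>\<^sup>+z. ennreal (dist z e) \<partial>M) \<le> (\<integral>\<^sup>+z. ennreal (1 + dist z e powr p) \<partial>M)"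
    using p by (intro nn_integral_mono ennreal_leI le_one_plus_powr) auto
  then have "(\<integral>\<^sup>+z. ennreal (dist z e) \<partial>M) < \<infinity>" using le
    by (metis ennreal_less_top infinity_ennreal_def le_less_trans)
  ultimately show "finite_first_moment e M" using M by (simp add: finite_first_moment_def)
qed

theorem KR_compact_of_moments:
  fixes P :: "nat \<Rightarrow> 'z::polish_space measure"
  assumes proper: "\<And>\<rho>. compact (cball e \<rho>)" and p: "1 < p" and C: "0 \<le> C"
    and P: "\<And>n. sets (P n) = sets borel"
    and le: "\<And>n. (\<integral>\<^sup>+z. ennreal (1 + dist z e powr p) \<partial>P n) \<le> ennreal C"
  obtains s Q where "strict_mono s" "finite_first_moment e Q" "KR_converges e (P \<circ> s) Q"
proof -
  have "\<exists>r :: 'z \<Rightarrow> 'z. finite (range r) \<and> r \<in> borel_measurable borel \<and>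
      (\<forall>z. dist z (r z) \<le> (1/2)^k / (C + 1) * (1 + dist z e powr p))" for k :: nat
    using exists_quantizer[OF proper p, of "(1/2)^k / (C + 1)"] C by (metis add_nonneg_pos divide_pos_pos half_gt_zero zero_less_one zero_less_power)
  then obtain r :: "nat \<Rightarrow> 'z \<Rightarrow> 'z" where r: "\<And>k. finite (range (r k))" "\<And>k. r k \<in> borel_measurable borel"
      "\<And>k z. dist z (r k z) \<le> (1/2)^k / (C + 1) * (1 + dist z e powr p)"
    by metis
  show thesis
  proof (rule KR_compact_of_quantizers[where P=P and e=e and C=C and r=r])
    show "finite_first_moment e (P n)" "measure (P n) UNIV \<le> C" for n
      using finite_first_moment_of_moment[OF P _ C le] mass_le_moment[OF P _ C le] p by auto
    show "(\<integral>\<^sup>+z. ennreal (dist z (r k z)) \<partial>P n) \<le> ennreal ((1/2)^k)" for k n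
    proof -
      note [measurable_cong] = P
      have "(\<integral>\<^sup>+z. ennreal (dist z (r k z)) \<partial>P n)
          \<le> (\<integral>\<^sup>+z. ennreal ((1/2)^k / (C + 1)) * ennreal (1 + dist z e powr p) \<partial>P n)"
      proof (rule nn_integral_mono)
        fix z
        have "ennreal (dist z (r k z)) \<le> ennreal ((1/2)^k / (C + 1) * (1 + dist z e powr p))"
          by (rule ennreal_leI) (rule r(3))
        also have "\<dots> = ennreal ((1/2)^k / (C + 1)) * ennreal (1 + dist z e powr p)"
          using C by (intro ennreal_mult) auto
        finally show "ennreal (dist z (r k z)) \<le> \<dots>" .
      qed
      also have "\<dots> = ennreal ((1/2)^k / (C + 1)) * (\<integral>\<^sup>+z. ennreal (1 + dist z e powr p) \<partial>P n)"
        by (rule nn_integral_cmult) measurable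
      also have "\<dots> \<le> ennreal ((1/2)^k / (C + 1)) * ennreal C" by (intro mult_left_mono le) auto
      also have "\<dots> = ennreal ((1/2)^k / (C + 1) * C)" using C by (intro ennreal_mult[symmetric]) auto
      also have "\<dots> \<le> ennreal ((1/2)^k)"
        using C mult_left_mono[of "C / (C + 1)" 1 "(1/2)^k"] by (intro ennreal_leI) simp
      finally show ?thesis .
    qed
  qed (rule r(1), rule r(2), rule that)
qed

section \<open>Limits of integrals and moments\<close>

lemma KR_converges_subseq:
  assumes "KR_converges e P Q" "strict_mono s"
  shows "KR_converges e (P \<circ> s) Q"
proof -
  have "filterlim s at_top sequentially" using assms(2) by (rule filterlim_subseq)
  then show ?thesis using assms(1) LIMSEQ_subseq_LIMSEQ[of "\<lambda>n. measure (P n) UNIV" _ s] assms(2)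
    unfolding KR_converges_def by (auto simp: comp_def filterlim_iff)
qed

lemma KR_converges_integral:
  fixes f :: "'z::metric_space \<Rightarrow> real"
  assumes conv: "KR_converges e P Q" and P: "\<And>n. finite_first_moment e (P n)" and Q: "finite_first_moment e Q"
    and f: "L-lipschitz_on UNIV f"
  shows "(\<lambda>n. integral\<^sup>L (P n) f) \<longlonglongrightarrow> integral\<^sup>L Q f"
proof -
  obtain g K where g: "g e = 0" "1-lipschitz_on UNIV g"
      "\<forall>M. finite_first_moment e M \<longrightarrow> integral\<^sup>L M f = K * integral\<^sup>L M g + measure M UNIV * f e"
    by (rule lipschitz_normalise[OF f, of e])
  have "(\<lambda>n. integral\<^sup>L (P n) g) \<longlonglongrightarrow> integral\<^sup>L Q g"
  proof (rule tendstoI)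
    fix \<epsilon> :: real assume "\<epsilon> > 0"
    then have "\<forall>\<^sub>F n in sequentially. \<forall>f :: 'z \<Rightarrow> real. f e = 0 \<longrightarrow> 1-lipschitz_on UNIV f \<longrightarrow>
        \<bar>integral\<^sup>L (P n) f - integral\<^sup>L Q f\<bar> \<le> \<epsilon>/2"
      using conv half_gt_zero[of \<epsilon>] unfolding KR_converges_def by blast
    then show "\<forall>\<^sub>F n in sequentially. dist (integral\<^sup>L (P n) g) (integral\<^sup>L Q g) < \<epsilon>"
    proof eventually_elim
      case (elim n)
      then have "\<bar>integral\<^sup>L (P n) g - integral\<^sup>L Q g\<bar> \<le> \<epsilon>/2" using g(1,2) by blast
      then show ?case using \<open>\<epsilon> > 0\<close> by (simp add: dist_real_def)
    qed
  qed
  then show ?thesis using conv unfolding g(3)[rule_format, OF P] g(3)[rule_format, OF Q] KR_converges_def by (intro tendsto_intros) auto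
qed

lemma KR_converges_add_measure:
  assumes c: "KR_converges e P Q" "KR_converges e P' Q'"
    and P: "\<And>n. finite_first_moment e (P n)" and Q: "finite_first_moment e Q"
    and P': "\<And>n. finite_first_moment e (P' n)" and Q': "finite_first_moment e Q'"
  shows "KR_converges e (\<lambda>n. add_measure (P n) (P' n)) (add_measure Q Q')"
  unfolding KR_converges_def
proof (intro conjI allI impI)
  show "(\<lambda>n. measure (add_measure (P n) (P' n)) UNIV) \<longlonglongrightarrow> measure (add_measure Q Q') UNIV"
    using c P Q P' Q' unfolding KR_converges_def
    by (auto simp: measure_add_measure finite_first_moment_def intro: tendsto_add)
  fix \<epsilon> :: real assume "\<epsilon> > 0"
  then have "\<epsilon>/2 > 0" by simp
  with c have "\<forall>\<^sub>F n in sequentially. \<forall>f :: 'a \<Rightarrow> real. f e = 0 \<longrightarrow> 1-lipschitz_on UNIV f \<longrightarrow>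
        \<bar>integral\<^sup>L (P n) f - integral\<^sup>L Q f\<bar> \<le> \<epsilon>/2"
      "\<forall>\<^sub>F n in sequentially. \<forall>f :: 'a \<Rightarrow> real. f e = 0 \<longrightarrow> 1-lipschitz_on UNIV f \<longrightarrow>
        \<bar>integral\<^sup>L (P' n) f - integral\<^sup>L Q' f\<bar> \<le> \<epsilon>/2"
    unfolding KR_converges_def by blast+
  then show "\<forall>\<^sub>F n in sequentially. \<forall>f :: 'a \<Rightarrow> real. f e = 0 \<longrightarrow> 1-lipschitz_on UNIV f \<longrightarrow>
        \<bar>integral\<^sup>L (add_measure (P n) (P' n)) f - integral\<^sup>L (add_measure Q Q') f\<bar> \<le> \<epsilon>"
  proof eventually_elim
    case (elim n)
    show ?case
    proof (intro allI impI)
      fix f :: "'a \<Rightarrow> real" assume f: "f e = 0" "1-lipschitz_on UNIV f"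
      have "integral\<^sup>L (add_measure M M') f = integral\<^sup>L M f + integral\<^sup>L M' f"
        if "finite_first_moment e M" "finite_first_moment e M'" for M M'
        using that f(2) by (intro integral_add_measure finite_first_moment_integrable_lipschitz finite_first_momentD)
      then have "integral\<^sup>L (add_measure (P n) (P' n)) f - integral\<^sup>L (add_measure Q Q') f =
          (integral\<^sup>L (P n) f - integral\<^sup>L Q f) + (integral\<^sup>L (P' n) f - integral\<^sup>L Q' f)"
        using P P' Q Q' by simp
      moreover have "\<bar>integral\<^sup>L (P n) f - integral\<^sup>L Q f\<bar> \<le> \<epsilon>/2" "\<bar>integral\<^sup>L (P' n) f - integral\<^sup>L Q' f\<bar> \<le> \<epsilon>/2"
        using elim f by blast+
      ultimately show "\<bar>integral\<^sup>L (add_measure (P n) (P' n)) f - integral\<^sup>L (add_measure Q Q') f\<bar> \<le> \<epsilon>"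
        by linarith
    qed
  qed
qed

lemma powr_diff_le:
  fixes x y b p :: real
  assumes "0 \<le> x" "x \<le> y" "y \<le> b" "1 \<le> p"
  shows "y powr p - x powr p \<le> p * b powr (p - 1) * (y - x)"
proof (cases "x = y")
  case False
  then have "x < y" using assms by simp
  have "\<exists>l z. x < z \<and> z < y \<and> DERIV (\<lambda>z. z powr p) z :> l \<and> y powr p - x powr p = (y - x) * l"
  proof (rule MVT[OF \<open>x < y\<close>])
    show "continuous_on {x..y} (\<lambda>z. z powr p)" using assms by (intro continuous_on_powr' continuous_intros) auto
    show "(\<lambda>z. z powr p) differentiable (at z)" if "x < z" for z
      using has_real_derivative_powr[of z p] that assms(1) by (auto simp: real_differentiable_def)
  qed
  then obtain l z where z: "x < z" "z < y" "DERIV (\<lambda>z. z powr p) z :> l"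
      "y powr p - x powr p = (y - x) * l" by blast
  have "l = p * z powr (p - 1)"
    using z(1,3) has_real_derivative_powr[of z p] assms(1) DERIV_unique by force
  also have "\<dots> \<le> p * b powr (p - 1)"
    using assms z by (intro mult_left_mono powr_mono2) auto
  finally show ?thesis using z(4) \<open>x < y\<close> by (simp add: mult.commute)
qed simp

lemma truncated_power_lipschitz:
  fixes e :: "'z::metric_space"
  assumes p: "1 \<le> p" and b: "0 \<le> b"
  shows "(p * b powr (p - 1))-lipschitz_on UNIV (\<lambda>z. 1 + min (dist z e) b powr p)"
proof (rule lipschitz_onI)
  fix x y :: 'z
  have le: "\<bar>min a b powr p - min c b powr p\<bar> \<le> p * b powr (p - 1) * \<bar>a - c\<bar>"
    if "0 \<le> c" "c \<le> a" for a c :: real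
  proof -
    have "min a b powr p - min c b powr p \<le> p * b powr (p - 1) * (min a b - min c b)"
      using that p b by (intro powr_diff_le) auto
    also have "\<dots> \<le> p * b powr (p - 1) * \<bar>a - c\<bar>"
      using that p by (intro mult_left_mono) auto
    finally show ?thesis using that p b powr_mono2[of p "min c b" "min a b"] by auto
  qed
  have "dist (1 + min (dist x e) b powr p) (1 + min (dist y e) b powr p)
      = \<bar>min (dist x e) b powr p - min (dist y e) b powr p\<bar>" by (simp add: dist_real_def)
  also have "\<dots> \<le> p * b powr (p - 1) * \<bar>dist x e - dist y e\<bar>"
    using le[of "dist y e" "dist x e"] le[of "dist x e" "dist y e"]
    by (cases "dist y e \<le> dist x e") (auto simp: abs_minus_commute)
  also have "\<dots> \<le> p * b powr (p - 1) * dist x y"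
    using p dist_triangle[of x e y] dist_triangle[of y e x]
    by (intro mult_left_mono) (auto simp: dist_commute[of y x])
  finally show "dist (1 + min (dist x e) b powr p) (1 + min (dist y e) b powr p) \<le> p * b powr (p - 1) * dist x y" .
qed (use p in simp)

text \<open>
  The integrand is the increasing limit of its truncations \<open>1 + (min (d(z, e)) i)\<^sup>p\<close>. These are
  Lipschitz, so their integrals converge along the sequence, and monotone convergence in \<open>i\<close>
  concludes.
\<close>

lemma moment_lower_semicontinuous:
  fixes e :: "'z::metric_space"
  assumes conv: "KR_converges e P Q" and P: "\<And>n. finite_first_moment e (P n)" and Q: "finite_first_moment e Q"
    and p: "1 \<le> p" and v: "(\<lambda>n. \<integral>\<^sup>+z. ennreal (1 + dist z e powr p) \<partial>P n) \<longlonglongrightarrow> v"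
  shows "(\<integral>\<^sup>+z. ennreal (1 + dist z e powr p) \<partial>Q) \<le> v"
proof -
  note [measurable_cong] = finite_first_momentD(1)[OF Q]
  define h where "h i z = 1 + min (dist z e) (real i) powr p" for i :: nat and z
  have h_lip: "(p * real i powr (p - 1))-lipschitz_on UNIV (h i)" for i
    unfolding h_def using p by (intro truncated_power_lipschitz) auto
  note [measurable] = lipschitz_on_UNIV_borel_measurable[OF h_lip]
  have h_le: "h i z \<le> h j z" if "i \<le> j" for i j z
    unfolding h_def using that p by (intro add_left_mono powr_mono2) auto
  have "(\<integral>\<^sup>+z. ennreal (1 + dist z e powr p) \<partial>Q) = (\<integral>\<^sup>+z. (SUP i. ennreal (h i z)) \<partial>Q)"
  proof (intro nn_integral_cong antisym)
    fix z
    obtain i where "dist z e \<le> real i" using real_arch_simple by blast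
    then have "h i z = 1 + dist z e powr p" by (simp add: h_def min_absorb1)
    then show "ennreal (1 + dist z e powr p) \<le> (SUP i. ennreal (h i z))"
      using SUP_upper[of i UNIV "\<lambda>i. ennreal (h i z)"] by simp
    show "(SUP i. ennreal (h i z)) \<le> ennreal (1 + dist z e powr p)"
      unfolding h_def using p by (intro SUP_least ennreal_leI add_left_mono powr_mono2) auto
  qed
  also have "\<dots> = (SUP i. \<integral>\<^sup>+z. ennreal (h i z) \<partial>Q)"
    by (rule nn_integral_monotone_convergence_SUP)
      (auto simp: incseq_def le_fun_def intro!: ennreal_leI h_le)
  also have "\<dots> \<le> v"
  proof (rule SUP_least)
    fix i
    have eq: "(\<integral>\<^sup>+z. ennreal (h i z) \<partial>M) = ennreal (integral\<^sup>L M (h i))" if "finite_first_moment e M" for M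
      by (intro nn_integral_eq_integral finite_first_moment_integrable_lipschitz[OF that h_lip])
        (simp add: h_def)
    have "(\<lambda>n. \<integral>\<^sup>+z. ennreal (h i z) \<partial>P n) \<longlonglongrightarrow> (\<integral>\<^sup>+z. ennreal (h i z) \<partial>Q)"
      unfolding eq[OF P] eq[OF Q]
      by (intro tendsto_ennrealI KR_converges_integral[OF conv P Q h_lip])
    moreover have "(\<integral>\<^sup>+z. ennreal (h i z) \<partial>P n) \<le> (\<integral>\<^sup>+z. ennreal (1 + dist z e powr p) \<partial>P n)" for n
      unfolding h_def using p by (intro nn_integral_mono ennreal_leI add_left_mono powr_mono2) auto
    ultimately show "(\<integral>\<^sup>+z. ennreal (h i z) \<partial>Q) \<le> v" using v by (intro LIMSEQ_le) auto
  qed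
  finally show ?thesis .
qed

section \<open>Compactness in the completion and the regularizer\<close>

text \<open>
  Extract convergent subsequences of the positive and of the negative variations, with limits
  \<open>PL\<close> and \<open>NL\<close>, and take \<open>\<nu> = PL - NL\<close>. These limits need not be mutually singular, but
  \<open>\<bar>\<nu>\<bar> \<le> PL + NL\<close>, which suffices for the moment bound.
\<close>

theorem KRu_moment_sublevel_compact:
  fixes e :: "'z::polish_space" and \<iota> :: "('z set \<Rightarrow> real) \<Rightarrow> 'k::banach"
  assumes \<iota>: "KRu_completion e \<iota>" and proper: "\<And>\<rho>. compact (cball e \<rho>)" and p: "1 < p" and C: "0 \<le> C"
    and \<mu>: "\<And>n. \<mu> n \<in> moment_measures e 1"
    and le: "\<And>n. (\<integral>\<^sup>+z. ennreal (1 + dist z e powr p) \<partial>total_variation (\<mu> n)) \<le> ennreal C"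
    and v: "(\<lambda>n. \<integral>\<^sup>+z. ennreal (1 + dist z e powr p) \<partial>total_variation (\<mu> n)) \<longlonglongrightarrow> v"
  obtains s \<nu> where "strict_mono s" "\<nu> \<in> moment_measures e 1" "(\<lambda>n. \<iota> (\<mu> (s n))) \<longlonglongrightarrow> \<iota> \<nu>"
    "(\<integral>\<^sup>+z. ennreal (1 + dist z e powr p) \<partial>total_variation \<nu>) \<le> v"
proof -
  let ?\<phi> = "\<lambda>z. ennreal (1 + dist z e powr p)"
  have [measurable]: "?\<phi> \<in> borel_measurable borel" by measurable
  define P N where "P n = positive_variation (\<mu> n)" and "N n = negative_variation (\<mu> n)" for n
  note D = moment_measures_1D[OF \<mu>]
  have P: "finite_first_moment e (P n)" and N: "finite_first_moment e (N n)" for n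
    using D by (auto simp: P_def N_def)
  note PD = finite_first_momentD[OF P] and ND = finite_first_momentD[OF N]
  have tv: "total_variation (\<mu> n) = add_measure (P n) (N n)" for n
    using total_variation_eq_add_measure[OF D(1)] by (simp add: P_def N_def)
  have split: "(\<integral>\<^sup>+z. ?\<phi> z \<partial>total_variation (\<mu> n)) = (\<integral>\<^sup>+z. ?\<phi> z \<partial>P n) + (\<integral>\<^sup>+z. ?\<phi> z \<partial>N n)" for n
    unfolding tv by (intro nn_integral_add_measure PD ND) measurable
  have leP: "(\<integral>\<^sup>+z. ?\<phi> z \<partial>P n) \<le> ennreal C" and leN: "(\<integral>\<^sup>+z. ?\<phi> z \<partial>N n) \<le> ennreal C" for n
    by (rule order_trans[OF _ le[of n, unfolded split]]; simp add: add_increasing add_increasing2)+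
  obtain s1 PL where s1: "strict_mono s1" "finite_first_moment e PL" "KR_converges e (P \<circ> s1) PL"
    by (rule KR_compact_of_moments[where P=P, OF proper p C PD(1) leP])
  obtain s2 NL where s2: "strict_mono s2" "finite_first_moment e NL" "KR_converges e ((N \<circ> s1) \<circ> s2) NL"
    by (rule KR_compact_of_moments[where P="N \<circ> s1", OF proper p C]) (simp_all only: comp_apply ND(1) leN)
  define s where "s = s1 \<circ> s2"
  have s: "strict_mono s" unfolding s_def using s1(1) s2(1) by (rule strict_mono_o)
  have cP: "KR_converges e (\<lambda>n. P (s n)) PL"
    using KR_converges_subseq[OF s1(3) s2(1)] by (simp add: comp_def s_def)
  have cN: "KR_converges e (\<lambda>n. N (s n)) NL" using s2(3) by (simp add: comp_def s_def)
  note PiD = finite_first_momentD[OF s1(2)] and NiD = finite_first_momentD[OF s2(2)]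
  define \<nu> where "\<nu> A = measure PL A - measure NL A" for A
  have \<nu>: "\<nu> \<in> moment_measures e 1"
    unfolding \<nu>_def using s1(2) s2(2) by (rule measure_diff_in_moment_measures_1)
  show thesis
  proof (rule that[OF s \<nu>])
    show "(\<lambda>n. \<iota> (\<mu> (s n))) \<longlonglongrightarrow> \<iota> \<nu>"
    proof (rule tendstoI)
      fix \<epsilon> :: real assume "\<epsilon> > 0"
      then have e4: "\<epsilon>/5 > 0" by simp
      have "(\<lambda>n. measure (P (s n)) UNIV - measure (N (s n)) UNIV) \<longlonglongrightarrow> measure PL UNIV - measure NL UNIV"
        using cP cN unfolding KR_converges_def by (intro tendsto_diff) auto
      then have "\<forall>\<^sub>F n in sequentially. dist (measure (P (s n)) UNIV - measure (N (s n)) UNIV) (measure PL UNIV - measure NL UNIV) < \<epsilon>/5"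
        using e4 by (rule tendstoD)
      moreover have "\<forall>\<^sub>F n in sequentially. \<forall>f :: 'z \<Rightarrow> real. f e = 0 \<longrightarrow> 1-lipschitz_on UNIV f \<longrightarrow>
          \<bar>integral\<^sup>L (P (s n)) f - integral\<^sup>L PL f\<bar> \<le> \<epsilon>/5"
        using cP e4 unfolding KR_converges_def by blast
      moreover have "\<forall>\<^sub>F n in sequentially. \<forall>f :: 'z \<Rightarrow> real. f e = 0 \<longrightarrow> 1-lipschitz_on UNIV f \<longrightarrow>
          \<bar>integral\<^sup>L (N (s n)) f - integral\<^sup>L NL f\<bar> \<le> \<epsilon>/5"
        using cN e4 unfolding KR_converges_def by blast
      ultimately show "\<forall>\<^sub>F n in sequentially. dist (\<iota> (\<mu> (s n))) (\<iota> \<nu>) < \<epsilon>"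
      proof eventually_elim
        case (elim n)
        let ?\<sigma> = "\<lambda>A. \<mu> (s n) A - \<nu> A"
        have \<sigma>: "?\<sigma> \<in> signed_borel_measures"
          using moment_measures_1_diff[OF \<mu> \<nu>] by (simp add: moment_measures_1_iff)
        have \<mu>_eq: "\<mu> (s n) A = measure (P (s n)) A - measure (N (s n)) A" for A
          using signed_borel_eq_variation_diff[OF D(1)] by (simp add: P_def N_def)
        have "KRu_norm e ?\<sigma> \<le> \<bar>?\<sigma> UNIV\<bar> + 2 * \<epsilon>/5"
        proof (rule KRu_norm_le[OF \<sigma>])
          show "finite_first_moment e (add_measure (P (s n)) NL)" "finite_first_moment e (add_measure (N (s n)) PL)"
            by (intro finite_first_moment_add_measure P N s1(2) s2(2))+
          show "?\<sigma> A = measure (add_measure (P (s n)) NL) A - measure (add_measure (N (s n)) PL) A" for A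
            by (simp add: measure_add_measure PD ND PiD NiD \<mu>_eq \<nu>_def)
          fix f :: "'z \<Rightarrow> real" assume f: "f e = 0" "1-lipschitz_on UNIV f"
          have add: "integral\<^sup>L (add_measure M M') f = integral\<^sup>L M f + integral\<^sup>L M' f"
            if "finite_first_moment e M" "finite_first_moment e M'" for M M'
            using that f(2) by (intro integral_add_measure finite_first_moment_integrable_lipschitz finite_first_momentD)
          have "\<bar>integral\<^sup>L (P (s n)) f - integral\<^sup>L PL f\<bar> \<le> \<epsilon>/5" "\<bar>integral\<^sup>L (N (s n)) f - integral\<^sup>L NL f\<bar> \<le> \<epsilon>/5"
            using elim f by blast+
          then show "integral\<^sup>L (add_measure (P (s n)) NL) f - integral\<^sup>L (add_measure (N (s n)) PL) f \<le> 2 * \<epsilon>/5"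
            unfolding add[OF P s2(2)] add[OF N s1(2)] by linarith
        qed
        moreover have "\<bar>?\<sigma> UNIV\<bar> < \<epsilon>/5" using elim(1) by (simp add: \<mu>_eq \<nu>_def dist_real_def)
        ultimately have "KRu_norm e ?\<sigma> < \<epsilon>" using \<open>\<epsilon> > 0\<close> by linarith
        then show ?case using KRu_completion_diff[OF \<iota> \<mu> \<nu>] by (simp add: dist_norm)
      qed
    qed
    have "(\<integral>\<^sup>+z. ?\<phi> z \<partial>total_variation \<nu>) \<le> (\<integral>\<^sup>+z. ?\<phi> z \<partial>add_measure PL NL)"
      using \<nu> PiD NiD
      by (intro nn_integral_mono_measure total_variation_le_add_measure)
        (auto simp: \<nu>_def moment_measures_1_iff)
    also have "\<dots> \<le> v"
    proof (rule moment_lower_semicontinuous)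
      show "KR_converges e (\<lambda>n. add_measure (P (s n)) (N (s n))) (add_measure PL NL)"
        by (intro KR_converges_add_measure cP cN P N s1(2) s2(2))
      show "(\<lambda>n. \<integral>\<^sup>+z. ?\<phi> z \<partial>add_measure (P (s n)) (N (s n))) \<longlonglongrightarrow> v"
        using LIMSEQ_subseq_LIMSEQ[OF v s] by (simp add: comp_def tv)
    qed (use p s1(2) s2(2) P N in \<open>auto intro!: finite_first_moment_add_measure\<close>)
    finally show "(\<integral>\<^sup>+z. ?\<phi> z \<partial>total_variation \<nu>) \<le> v" .
  qed
qed

text \<open>
  Uses that \<open>\<bar>\<mu>\<bar>\<close> is finite: a finite \<open>p\<close>-th moment alone does not control the first moment near
  \<open>e\<close>.
\<close>

lemma moment_measures_subset_1:
  assumes "1 \<le> p"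
  shows "moment_measures e p \<subseteq> moment_measures e 1"
proof
  fix \<mu> assume m: "\<mu> \<in> moment_measures e p"
  then have \<mu>: "\<mu> \<in> signed_borel_measures" and fin: "(\<integral>\<^sup>+z. ennreal (dist z e powr p) \<partial>total_variation \<mu>) < \<infinity>"
    by (auto simp: moment_measures_def)
  interpret finite_measure "total_variation \<mu>"
    using \<mu> by (simp add: total_variation_eq_add_measure finite_measure_add_measure
        finite_measure_positive_variation finite_measure_negative_variation)
  have "(\<integral>\<^sup>+z. ennreal (dist z e) \<partial>total_variation \<mu>) \<le> (\<integral>\<^sup>+z. 1 + ennreal (dist z e powr p) \<partial>total_variation \<mu>)"
    using le_one_plus_powr[OF _ assms] by (intro nn_integral_mono) (simp add: ennreal_1[symmetric] ennreal_leI flip: ennreal_plus del: ennreal_1)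
  also have "\<dots> = emeasure (total_variation \<mu>) (space (total_variation \<mu>)) + (\<integral>\<^sup>+z. ennreal (dist z e powr p) \<partial>total_variation \<mu>)"
    by (subst nn_integral_add) auto
  also have "\<dots> < \<infinity>" using fin by (simp add: emeasure_eq_measure ennreal_add_less_top)
  finally show "\<mu> \<in> moment_measures e 1" using \<mu> finite_measure_axioms
    by (simp add: moment_measures_1_iff finite_first_moment_def)
qed

lemma regularizer_eq:
  assumes \<iota>: "KRu_completion e \<iota>" and \<mu>: "\<mu> \<in> moment_measures e 1"
    and fin: "(\<integral>\<^sup>+z. ennreal (1 + dist z e powr p) \<partial>total_variation \<mu>) < \<infinity>"
  shows "regularizer e \<iota> p \<alpha> \<beta> (\<iota> \<mu>) = ennreal (\<alpha> * norm (\<iota> \<mu>)) +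
    ennreal \<beta> * (\<integral>\<^sup>+z. ennreal (1 + dist z e powr p) \<partial>total_variation \<mu>)"
proof -
  have "(\<integral>\<^sup>+z. ennreal (dist z e powr p) \<partial>total_variation \<mu>) \<le> (\<integral>\<^sup>+z. ennreal (1 + dist z e powr p) \<partial>total_variation \<mu>)"
    by (intro nn_integral_mono ennreal_leI) auto
  then have "\<mu> \<in> moment_measures e p"
    using \<mu> fin by (auto simp: moment_measures_def)
  then show ?thesis
    using inv_into_f_f[OF KRu_completion_inj_on[OF \<iota>] \<mu>] by (auto simp: regularizer_def)
qed

lemma regularizer_finite_cases:
  assumes \<iota>: "KRu_completion e \<iota>" and p: "1 \<le> p" and \<beta>: "0 < \<beta>" and fin: "regularizer e \<iota> p \<alpha> \<beta> x < \<infinity>"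
  obtains \<mu> where "\<mu> \<in> moment_measures e 1" "x = \<iota> \<mu>"
    "(\<integral>\<^sup>+z. ennreal (1 + dist z e powr p) \<partial>total_variation \<mu>) < \<infinity>"
proof -
  obtain \<mu> where \<mu>: "\<mu> \<in> moment_measures e p" "x = \<iota> \<mu>"
    using fin by (auto simp: regularizer_def split: if_splits)
  have \<mu>1: "\<mu> \<in> moment_measures e 1" using \<mu>(1) moment_measures_subset_1[OF p] by blast
  have "regularizer e \<iota> p \<alpha> \<beta> x = ennreal (\<alpha> * norm x) +
      ennreal \<beta> * (\<integral>\<^sup>+z. ennreal (1 + dist z e powr p) \<partial>total_variation \<mu>)"
    using \<mu> inv_into_f_f[OF KRu_completion_inj_on[OF \<iota>] \<mu>1] by (auto simp: regularizer_def)
  then have "ennreal \<beta> * (\<integral>\<^sup>+z. ennreal (1 + dist z e powr p) \<partial>total_variation \<mu>) < \<infinity>"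
    using fin by (simp add: ennreal_add_less_top)
  then have "(\<integral>\<^sup>+z. ennreal (1 + dist z e powr p) \<partial>total_variation \<mu>) < \<infinity>"
    using \<beta> by (auto simp: ennreal_mult_less_top)
  with \<mu>1 \<mu>(2) show thesis by (rule that)
qed

section \<open>Convex functions on a Hilbert space\<close>

text \<open>
  The lower limit in the definition is over a punctured neighbourhood of \<open>h\<close>, whereas the
  sequence may hit \<open>h\<close>; there the bound holds by assumption.
\<close>

lemma lower_semicontinuous_seq_less:
  fixes F :: "'a::first_countable_topology \<Rightarrow> ereal"
  assumes "lower_semicontinuous F" "y \<longlonglongrightarrow> h" "c < F h"
  shows "eventually (\<lambda>n. c < F (y n)) sequentially"
proof -
  have "c < Liminf (at h) F" using assms(1,3) unfolding lower_semicontinuous_def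
    by (metis less_le_trans)
  then have "eventually (\<lambda>x. c < F x) (at h)" by (rule less_LiminfD)
  then have "eventually (\<lambda>x. c < F x) (nhds h)"
    unfolding eventually_at_filter by (rule eventually_mono) (use assms(3) in auto)
  then show ?thesis using assms(2) unfolding filterlim_iff by blast
qed

lemma lower_semicontinuous_le_liminf:
  fixes F :: "'a::first_countable_topology \<Rightarrow> ereal"
  assumes "lower_semicontinuous F" "y \<longlonglongrightarrow> h"
  shows "F h \<le> liminf (\<lambda>n. F (y n))"
  unfolding le_Liminf_iff using lower_semicontinuous_seq_less[OF assms] by blast

lemma convex_fun_midpoint_le:
  fixes F :: "'h::real_vector \<Rightarrow> ereal"
  assumes "convex_fun F" "F x \<le> ereal c" "F y \<le> ereal c"
  shows "F ((1/2) *\<^sub>R x + (1/2) *\<^sub>R y) \<le> ereal c"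
proof -
  have "F ((1 - 1/2) *\<^sub>R x + (1/2) *\<^sub>R y) \<le> ereal (1 - 1/2) * F x + ereal (1/2) * F y"
    using assms(1)[unfolded convex_fun_def, rule_format, of "1/2" x y] by simp
  also have "\<dots> \<le> ereal (1 - 1/2) * ereal c + ereal (1/2) * ereal c"
    using assms(2,3) by (intro add_mono ereal_mult_left_mono) auto
  also have "\<dots> = ereal c" by (simp add: field_simps)
  finally show ?thesis by simp
qed

text \<open>
  Take elements of \<open>C n\<close> of almost minimal norm. The minimal norms \<open>d n\<close> increase to a finite
  limit, and midpoints of elements of \<open>C m\<close> have norm at least \<open>d m\<close>, so the parallelogram law
  forces the elements to be close to each other.
\<close>

lemma nested_midpoint_convex_Cauchy:
  fixes C :: "nat \<Rightarrow> 'h::real_inner set"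
  assumes ne: "\<And>n. C n \<noteq> {}" and dec: "\<And>m n. m \<le> n \<Longrightarrow> C n \<subseteq> C m"
    and mid: "\<And>n x y. x \<in> C n \<Longrightarrow> y \<in> C n \<Longrightarrow> (1/2) *\<^sub>R x + (1/2) *\<^sub>R y \<in> C n"
    and bd: "\<And>x. x \<in> C 0 \<Longrightarrow> norm x \<le> R"
  obtains x where "\<And>n. x n \<in> C n" "Cauchy x"
proof -
  define d where "d n = Inf (norm ` C n)" for n
  have bb: "bdd_below (norm ` C n)" for n by (auto intro: bdd_belowI[of _ 0])
  have d_le: "d n \<le> norm x" if "x \<in> C n" for n x
    unfolding d_def using that bb by (auto intro: cInf_lower)
  have d_ge: "0 \<le> d n" for n
    unfolding d_def using ne by (intro cInf_greatest) auto
  have "\<exists>x\<in>C n. norm x < d n + inverse (real (Suc n))" for n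
  proof -
    have "Inf (norm ` C n) < d n + inverse (real (Suc n))" by (simp add: d_def)
    then show ?thesis using cInf_lessD[of "norm ` C n"] ne by blast
  qed
  then obtain x where x: "\<And>n. x n \<in> C n" "\<And>n. norm (x n) < d n + inverse (real (Suc n))"
    by metis
  have d_mono: "d m \<le> d n" if "m \<le> n" for m n
    unfolding d_def using ne bb dec[OF that] by (intro cInf_superset_mono) auto
  have d_R: "d n \<le> R" for n
    using d_le[OF x(1)[of n]] bd dec[of 0 n] x(1)[of n] by force
  obtain D where D: "d \<longlonglongrightarrow> D"
    by (rule incseq_convergent[of d R]) (use d_mono d_R in \<open>auto simp: incseq_def\<close>)
  have sq: "(norm (x m - x n))\<^sup>2 \<le> 4 * (d n + inverse (real (Suc m)))\<^sup>2 - 4 * (d m)\<^sup>2"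
    if "m \<le> n" for m n
  proof -
    have 1: "d m \<le> norm ((1/2) *\<^sub>R x m + (1/2) *\<^sub>R x n)"
      using x(1) dec[OF that] by (intro d_le mid) auto
    have "(d m)\<^sup>2 \<le> (norm ((1/2) *\<^sub>R x m + (1/2) *\<^sub>R x n))\<^sup>2"
      using 1 d_ge by (intro power_mono) auto
    moreover have "(norm (x m - x n))\<^sup>2 = 2 * (norm (x m))\<^sup>2 + 2 * (norm (x n))\<^sup>2 - 4 * (norm ((1/2) *\<^sub>R x m + (1/2) *\<^sub>R x n))\<^sup>2"
      by (simp add: power2_norm_eq_inner inner_simps inner_commute algebra_simps)
    moreover have "norm (x m) \<le> d n + inverse (real (Suc m))"
      using x(2)[of m] d_mono[OF that] by simp
    then have "(norm (x m))\<^sup>2 \<le> (d n + inverse (real (Suc m)))\<^sup>2"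
      by (intro power_mono) auto
    moreover have "inverse (real (Suc n)) \<le> inverse (real (Suc m))"
      using that by (intro le_imp_inverse_le) auto
    then have "norm (x n) \<le> d n + inverse (real (Suc m))"
      using x(2)[of n] by linarith
    then have "(norm (x n))\<^sup>2 \<le> (d n + inverse (real (Suc m)))\<^sup>2"
      by (intro power_mono) auto
    ultimately show ?thesis by linarith
  qed
  have sq2: "(norm (x m - x n))\<^sup>2 \<le> 4 * (D + inverse (real (Suc m)))\<^sup>2 - 4 * (d m)\<^sup>2"
    if "m \<le> n" for m n
  proof -
    have "d n \<le> D" using D d_mono by (intro incseq_le) (auto simp: incseq_def)
    then have "(d n + inverse (real (Suc m)))\<^sup>2 \<le> (D + inverse (real (Suc m)))\<^sup>2"
      using d_ge[of n] by (intro power_mono) auto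
    then show ?thesis using sq[OF that] by linarith
  qed
  have lim: "(\<lambda>m. 4 * (D + inverse (real (Suc m)))\<^sup>2 - 4 * (d m)\<^sup>2) \<longlonglongrightarrow> 4 * (D + 0)\<^sup>2 - 4 * D\<^sup>2"
    by (intro tendsto_intros D LIMSEQ_inverse_real_of_nat)
  have "Cauchy x"
  proof (rule metric_CauchyI)
    fix \<epsilon> :: real assume "\<epsilon> > 0"
    then have "eventually (\<lambda>m. 4 * (D + inverse (real (Suc m)))\<^sup>2 - 4 * (d m)\<^sup>2 < (\<epsilon>/2)\<^sup>2) sequentially"
      using order_tendstoD(2)[OF lim, of "(\<epsilon>/2)\<^sup>2"] by simp
    then obtain m where m: "4 * (D + inverse (real (Suc m)))\<^sup>2 - 4 * (d m)\<^sup>2 < (\<epsilon>/2)\<^sup>2"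
      using eventually_happens[of _ sequentially] by auto
    have "norm (x m - x n) < \<epsilon>/2" if "m \<le> n" for n
      using sq2[OF that] m \<open>\<epsilon> > 0\<close> by (intro power2_less_imp_less[of _ "\<epsilon>/2"]) auto
    then have "dist (x i) (x j) < \<epsilon>" if "m \<le> i" "m \<le> j" for i j
      using that dist_triangle_half_r[of "x m" "x i" \<epsilon> "x j"] by (auto simp: dist_norm)
    then show "\<exists>M. \<forall>m\<ge>M. \<forall>n\<ge>M. dist (x m) (x n) < \<epsilon>" by blast
  qed
  with x(1) that show thesis by blast
qed

text \<open>
  If the sublevel sets at all levels \<open>- n\<close> were nonempty, a Cauchy sequence through these nested
  bounded convex sets would converge to a point at which, by lower semicontinuity, \<open>F\<close> is \<open>-\<infinity>\<close>.
\<close>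

lemma coercive_convex_lsc_bounded_below:
  fixes F :: "'h::{real_inner, complete_space} \<Rightarrow> ereal"
  assumes "proper_fun F" "convex_fun F" "coercive F" "lower_semicontinuous F"
  obtains c :: real where "\<And>h. ereal c \<le> F h"
proof (rule ccontr)
  assume nt: "\<not> thesis"
  define C where "C n = {h. F h \<le> ereal (- real n)}" for n
  have ne: "C n \<noteq> {}" for n
  proof
    assume "C n = {}"
    then have "ereal (- real n) \<le> F h" for h unfolding C_def
      by (metis (mono_tags, lifting) empty_iff mem_Collect_eq nle_le)
    then show False using nt that by blast
  qed
  have dec: "C n \<subseteq> C m" if "m \<le> n" for m n
    unfolding C_def using that order_trans by fastforce
  have mid: "(1/2) *\<^sub>R x + (1/2) *\<^sub>R y \<in> C n" if "x \<in> C n" "y \<in> C n" for n x y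
    using that convex_fun_midpoint_le[OF assms(2)] unfolding C_def by blast
  have "eventually (\<lambda>h. F h > 0) at_infinity"
    using assms(3) unfolding coercive_def by (rule order_tendstoD) simp
  then obtain b where b: "\<And>h. b \<le> norm h \<Longrightarrow> F h > 0"
    unfolding eventually_at_infinity by blast
  have bd: "norm x \<le> b" if "x \<in> C 0" for x
    using that b[of x] unfolding C_def by (force simp: zero_ereal_def)
  obtain x where x: "\<And>n. x n \<in> C n" "Cauchy x"
    using nested_midpoint_convex_Cauchy[of C b] ne dec mid bd by metis
  then obtain h where h: "x \<longlonglongrightarrow> h" using Cauchy_convergent convergent_def by blast
  have "F h \<le> ereal (- real n)" for n
  proof (rule ccontr)
    assume "\<not> F h \<le> ereal (- real n)"
    then have "eventually (\<lambda>m. ereal (- real n) < F (x m)) sequentially"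
      using lower_semicontinuous_seq_less[OF assms(4) h] by (simp add: not_le)
    then have "eventually (\<lambda>m. ereal (- real n) < F (x m) \<and> m \<ge> n) sequentially"
      using eventually_ge_at_top by (rule eventually_conj)
    then obtain m where m: "ereal (- real n) < F (x m)" "m \<ge> n"
      using eventually_happens[of _ sequentially] by auto
    have "x m \<in> C n" using x(1) dec[OF m(2)] by blast
    with m(1) show False by (simp add: C_def)
  qed
  then have a: "F h \<le> ereal (- real n)" for n by blast
  have "F h \<le> ereal B" for B
  proof -
    obtain n where "- B \<le> real n" using real_arch_simple by blast
    then show ?thesis using a[of n] order_trans[of "F h" "ereal (- real n)" "ereal B"] by simp
  qed
  then have "F h = -\<infinity>" by (rule ereal_bot)
  then show False using assms(1) unfolding proper_fun_def by blast
qed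

section \<open>Existence of a minimizer\<close>

theorem theorem4p4:
  fixes e :: "'z::polish_space"
    and \<iota> :: "('z set \<Rightarrow> real) \<Rightarrow> 'k::banach"
    and p \<alpha> \<beta> :: real
    and \<A> :: "'k \<Rightarrow> 'h::{real_inner, complete_space}"
    and F :: "'h \<Rightarrow> ereal"
  assumes "locally_compact_space (euclidean :: 'z topology)"
    and "geodesic_space TYPE('z)"
    and "KRu_completion e \<iota>"
    and "p > 1" and "\<alpha> \<ge> 0" and "\<beta> > 0"
    and "bounded_linear \<A>"
    and "proper_fun F" and "convex_fun F" and "coercive F" and "lower_semicontinuous F"
  shows "\<exists>\<mu>. F (\<A> \<mu>) + enn2ereal (regularizer e \<iota> p \<alpha> \<beta> \<mu>)
             = (INF \<nu>. F (\<A> \<nu>) + enn2ereal (regularizer e \<iota> p \<alpha> \<beta> \<nu>))"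
proof -
  note \<iota> = assms(3) and p = assms(4) and \<alpha> = assms(5) and \<beta> = assms(6)
  have proper: "compact (cball e \<rho>)" for \<rho> using assms(1,2) by (rule Hopf_Rinow_Cohn_Vossen)
  obtain c :: real where c: "\<And>h. ereal c \<le> F h"
    using coercive_convex_lsc_bounded_below[OF assms(8-11)] by blast
  define reg where "reg = regularizer e \<iota> p \<alpha> \<beta>"
  define J where "J x = F (\<A> x) + enn2ereal (reg x)" for x
  define m where "m = (INF x. J x)"
  have m_le: "m \<le> J x" for x unfolding m_def by (rule INF_lower) simp
  have "\<exists>x. J x = m"
  proof (cases "m = \<infinity>")
    case True
    then show ?thesis using m_le[of 0] by auto
  next
    case False
    have "ereal c \<le> m" unfolding m_def J_def
    proof (rule INF_greatest)
      fix x show "ereal c \<le> F (\<A> x) + enn2ereal (reg x)"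
        using add_mono[OF c[of "\<A> x"] enn2ereal_nonneg[of "reg x"]] by simp
    qed
    with False obtain m' where m': "m = ereal m'" by (cases m) auto
    obtain f where f: "decseq f" "range f \<subseteq> range J" "m = (INF i. f i)"
      using Inf_countable_INF[of "range J"] by (auto simp: m_def)
    have "\<forall>n. \<exists>x. f n = J x" using f(2) by auto
    then obtain x where x: "\<And>n. f n = J (x n)" by metis
    have x_lim: "(\<lambda>n. J (x n)) \<longlonglongrightarrow> m"
      using LIMSEQ_INF[OF f(1)] unfolding f(3)[symmetric] unfolding x .
    have "m < ereal (m' + 1)" by (simp add: m')
    then have "\<forall>\<^sub>F n in sequentially. J (x n) < ereal (m' + 1)"
      using x_lim by (intro order_tendstoD(2))
    then obtain k where k: "\<And>n. n \<ge> k \<Longrightarrow> J (x n) < ereal (m' + 1)"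
      unfolding eventually_sequentially by blast
    define y where "y n = x (n + k)" for n
    have y_lim: "(\<lambda>n. J (y n)) \<longlonglongrightarrow> m"
      unfolding y_def by (rule LIMSEQ_ignore_initial_segment[OF x_lim])
    \<comment> \<open>Since \<open>F \<ge> c\<close> and the values are below \<open>m + 1\<close>, this bounds the regularizer on the sequence.\<close>
    define B where "B = max 0 (m' + 1 - c)"
    have reg_le: "reg (y n) \<le> ennreal B" for n
    proof -
      have "ereal c + enn2ereal (reg (y n)) \<le> ereal (m' + 1)"
        using order_trans[OF add_right_mono[OF c[of "\<A> (y n)"], of "enn2ereal (reg (y n))"]]
          less_imp_le[OF k[of "n + k"]] by (simp add: J_def y_def)
      moreover have "m' + 1 - c \<le> B" by (simp add: B_def)
      ultimately have "enn2ereal (reg (y n)) \<le> ereal B"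
        by (cases "enn2ereal (reg (y n))") auto
      then show ?thesis by (metis B_def enn2ereal_ennreal less_eq_ennreal.rep_eq max.cobounded1)
    qed
    have "\<forall>n. \<exists>\<mu>. \<mu> \<in> moment_measures e 1 \<and> y n = \<iota> \<mu> \<and>
        (\<integral>\<^sup>+z. ennreal (1 + dist z e powr p) \<partial>total_variation \<mu>) < \<infinity>"
    proof
      fix n
      have "regularizer e \<iota> p \<alpha> \<beta> (y n) < \<infinity>"
        using reg_le[of n] ennreal_less_top le_less_trans unfolding reg_def infinity_ennreal_def by blast
      then show "\<exists>\<mu>. \<mu> \<in> moment_measures e 1 \<and> y n = \<iota> \<mu> \<and>
        (\<integral>\<^sup>+z. ennreal (1 + dist z e powr p) \<partial>total_variation \<mu>) < \<infinity>"
        using regularizer_finite_cases[OF \<iota> _ \<beta>] p by (metis less_imp_le)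
    qed
    then obtain \<mu> where \<mu>: "\<And>n. \<mu> n \<in> moment_measures e 1" "\<And>n. y n = \<iota> (\<mu> n)"
        "\<And>n. (\<integral>\<^sup>+z. ennreal (1 + dist z e powr p) \<partial>total_variation (\<mu> n)) < \<infinity>"
      by metis
    define V where "V \<nu> = (\<integral>\<^sup>+z. ennreal (1 + dist z e powr p) \<partial>total_variation \<nu>)" for \<nu> :: "'z set \<Rightarrow> real"
    have reg_y: "reg (y n) = ennreal (\<alpha> * norm (y n)) + ennreal \<beta> * V (\<mu> n)" for n
      unfolding reg_def V_def \<mu>(2) by (rule regularizer_eq[OF \<iota> \<mu>(1,3)])
    have V_le: "V (\<mu> n) \<le> ennreal (B / \<beta>)" for n
    proof -
      have "V (\<mu> n) = ennreal (1/\<beta>) * (ennreal \<beta> * V (\<mu> n))"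
        using \<beta> by (simp add: mult.assoc[symmetric] ennreal_mult[symmetric])
      also have "\<dots> \<le> ennreal (1/\<beta>) * reg (y n)"
        unfolding reg_y by (intro mult_left_mono) (auto intro: add_increasing)
      also have "\<dots> \<le> ennreal (1/\<beta>) * ennreal B" by (intro mult_left_mono reg_le) auto
      also have "\<dots> = ennreal (B / \<beta>)" using \<beta> by (simp add: ennreal_mult[symmetric] B_def)
      finally show ?thesis .
    qed
    have B\<beta>: "0 \<le> B / \<beta>" using \<beta> by (simp add: B_def)
    obtain v s0 where s0: "strict_mono (s0 :: nat \<Rightarrow> nat)" "((\<lambda>n. V (\<mu> n)) \<circ> s0) \<longlonglongrightarrow> v"
      using compact_complete_linorder by blast
    have v_le: "v \<le> ennreal (B / \<beta>)"
      using s0(2) V_le by (intro LIMSEQ_le_const2[where X="(\<lambda>n. V (\<mu> n)) \<circ> s0"]) auto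
    obtain s1 \<nu> where s1: "strict_mono s1" "\<nu> \<in> moment_measures e 1"
        "(\<lambda>n. \<iota> (\<mu> (s0 (s1 n)))) \<longlonglongrightarrow> \<iota> \<nu>" "V \<nu> \<le> v"
      unfolding V_def
      by (rule KRu_moment_sublevel_compact[where \<mu>="\<lambda>n. \<mu> (s0 n)" and v=v, OF \<iota> proper p B\<beta> \<mu>(1)])
        (use V_le s0(2) in \<open>simp_all add: V_def comp_def\<close>)
    define s where "s n = s0 (s1 n)" for n
    have y_conv: "(\<lambda>n. y (s n)) \<longlonglongrightarrow> \<iota> \<nu>" using s1(3) by (simp add: s_def \<mu>(2))
    have V_conv: "(\<lambda>n. V (\<mu> (s n))) \<longlonglongrightarrow> v"
      using LIMSEQ_subseq_LIMSEQ[OF s0(2) s1(1)] by (simp add: comp_def s_def)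
    have J_conv: "(\<lambda>n. J (y (s n))) \<longlonglongrightarrow> m"
      using LIMSEQ_subseq_LIMSEQ[OF y_lim strict_mono_o[OF s0(1) s1(1)]] by (simp add: comp_def s_def)
    \<comment> \<open>The limit of the regularizers along the subsequence; it bounds the regularizer of \<open>\<iota> \<nu>\<close>.\<close>
    define g where "g = ennreal (\<alpha> * norm (\<iota> \<nu>)) + ennreal \<beta> * v"
    have v_fin: "v < \<infinity>" using v_le ennreal_less_top le_less_trans by (metis infinity_ennreal_def)
    have "reg (\<iota> \<nu>) = ennreal (\<alpha> * norm (\<iota> \<nu>)) + ennreal \<beta> * V \<nu>"
      unfolding reg_def V_def using s1(4) v_fin
      by (intro regularizer_eq[OF \<iota> s1(2)]) (auto simp: V_def intro: le_less_trans)
    then have reg_le_g: "reg (\<iota> \<nu>) \<le> g" using s1(4) by (auto simp: g_def intro!: add_mono mult_left_mono)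
    have "(\<lambda>n. reg (y (s n))) \<longlonglongrightarrow> g"
      unfolding reg_y g_def
      by (intro tendsto_add tendsto_ennrealI tendsto_mult_left tendsto_norm y_conv ennreal_tendsto_cmult V_conv) simp
    then have reg_conv: "(\<lambda>n. enn2ereal (reg (y (s n)))) \<longlonglongrightarrow> enn2ereal g"
      by (rule tendsto_enn2erealI)
    have g_fin: "enn2ereal g \<noteq> \<infinity>" "enn2ereal g \<noteq> -\<infinity>"
    proof -
      have "g < \<infinity>" using v_fin by (simp add: g_def ennreal_add_less_top ennreal_mult_less_top)
      then show "enn2ereal g \<noteq> \<infinity>" by (metis enn2ereal_eq_top_iff infinity_ereal_def less_irrefl top_ereal_def infinity_ennreal_def)
      show "enn2ereal g \<noteq> -\<infinity>" using enn2ereal_nonneg[of g] by auto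
    qed
    have "F (\<A> (\<iota> \<nu>)) \<le> liminf (\<lambda>n. F (\<A> (y (s n))))"
      using y_conv by (intro lower_semicontinuous_le_liminf[OF assms(11)] bounded_linear.tendsto[OF assms(7)])
    moreover have lg: "liminf (\<lambda>n. enn2ereal (reg (y (s n)))) = enn2ereal g"
      using reg_conv by (intro lim_imp_Liminf) auto
    moreover have "liminf (\<lambda>n. J (y (s n))) = m" using J_conv by (intro lim_imp_Liminf) auto
    moreover have "liminf (\<lambda>n. F (\<A> (y (s n)))) + liminf (\<lambda>n. enn2ereal (reg (y (s n)))) \<le> liminf (\<lambda>n. J (y (s n)))"
      unfolding J_def using g_fin lg by (intro ereal_liminf_add_mono) auto
    moreover have "enn2ereal (reg (\<iota> \<nu>)) \<le> enn2ereal g" using reg_le_g by (simp add: less_eq_ennreal.rep_eq)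
    ultimately have "J (\<iota> \<nu>) \<le> m" unfolding J_def by (metis add_mono order_trans)
    then show ?thesis using m_le[of "\<iota> \<nu>"] by (intro exI[of _ "\<iota> \<nu>"]) simp
  qed
  then show ?thesis by (simp add: J_def reg_def m_def)
qed

end
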